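(* Let $(\Omega,\mathcal{F},\mathbb{P})$ be a complete probability space, let $X_1,X_2,W,R$ be real, reflexive, separable Banach spaces, and let the data $C_1,C_2,K,J_1,J_2,e,i$ satisfy the Basic Assumption stated in the context. Then $(\bar{x},\bar{\lambda})$ with $\bar{x}=(\bar{x}_1,\bar{x}_2)\in X_1\times L^\infty(\Omega,X_2)$ and $\bar{\lambda}=(\bar{\lambda}_e,\bar{\lambda}_i)\in L^1(\Omega,W^* )\times L^1(\Omega,R^* )$ is a saddle point of the Lagrangian $L$ (defined in the context) if and only if there exists a function $\rho\in L^1(\Omega,X_1^* )$ such that the following conditions are satisfied: (i) The function $x_1\mapsto J_1(x_1)+\langle\mathbb{E}[\rho],x_1\rangle_{X_1^*,X_1}$ attains its minimum over $C_1$ at $\bar{x}_1$. (ii) The function $$(x_1,x_2)\mapsto J_2(x_1,x_2)+\langle\bar{\lambda}_e(\omega),e(x_1,x_2,\omega)\rangle_{W^*,W}+\langle\bar{\lambda}_i(\omega),i(x_1,x_2,\omega)\rangle_{R^*,R}-\langle\rho(\omega),x_1\rangle_{X_1^*,X_1}$$ attains its minimum in $X_1\times C_2$ at $(\bar{x}_1,\bar{x}_2(\omega))$ for almost every $\omega\in\Omega$. (iii) It holds that $\bar{x}_1\in C_1$ and the following conditions hold almost surely: $$e(\bar{x}_1,\bar{x}_2(\omega),\omega)=0,\quad\bar{x}_2(\omega)\in C_2,\quad\bar{\lambda}_i(\omega)\in K^\oplus,$$ $$i(\bar{x}_1,\bar{x}_2(\omega),\omega)\le_K0,\quad\langle\b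ar{\lambda}_i(\omega),i(\bar{x}_1,\bar{x}_2(\omega),\omega)\rangle_{R^*,R}=0.$$
   Context: Basic Assumption. $C_1\subset X_1$ and $C_2\subset X_2$ are nonempty, closed, convex sets and $K\subset R$ is a nonempty, closed, convex cone. $J(x_1,x_2)=J_1(x_1)+J_2(x_1,x_2)$ is convex on $X_1\times X_2$ and everywhere defined and finite; for every $r>0$ there is $a_r>0$ such that $|J_2(x_1,x_2)|\le a_r$ whenever $\|x_1\|_{X_1}+\|x_2\|_{X_2}\le r$. The maps $e:X_1\times X_2\times\Omega\to W$ and $i:X_1\times X_2\times\Omega\to R$ are such that $e(x_1,x_2,\omega)$ is continuous and linear in $(x_1,x_2)$, $i(x_1,x_2,\omega)$ is continuous and $K$-convex in $(x_1,x_2)$, both are measurable (in $\omega$), and for every $r>0$ there are $b_{r,e},b_{r,i}>0$ such that $\|e(x_1,x_2,\omega)\|_W\le b_{r,e}$ and $\|i(x_1,x_2,\omega)\|_R\le b_{r,i}$ a.s. whenever $\|x_1\|_{X_1}+\|x_2\|_{X_2}\le r$. Here $r\le_K 0$ means $-r\in K$ (and $r\le_K r'$ means $r'-r\in K$), and $K$-convexity of $i(\cdot,\cdot,\omega)$ means $i(\lambda x_1+(1-\lambda)\hat{x}_1,\lambda x_2+(1-\lambda)\hat{x}_2,\omega)\le_K\lambda i(x_1,x_2,\omega)+(1-\lambda)i(\hat{x}_1,\hat{x}_2,\omega)$ for all $(x_1,x_2),(\hat{x}_1,\hat{x}_2)\in X_1\times X_2$ and $\lambda\in(0,1)$. The dual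 cone is $K^\oplus:=\{r^*\in R^*:\langle r^*,r\rangle_{R^*,R}\ge0\ \forall r\in K\}$. Put $X:=X_1\times L^\infty(\Omega,X_2)$, $\Lambda:=L^1(\Omega,W^* )\times L^1(\Omega,R^* )$ (Bochner spaces), $X_0:=\{(x_1,x_2)\in X:x_1\in C_1,\ x_2(\omega)\in C_2\text{ a.s.}\}$, $\Lambda_0:=\{(\lambda_e,\lambda_i)\in\Lambda:\lambda_i(\omega)\in K^\oplus\text{ a.s.}\}$. The Lagrangian on $X\times\Lambda$ is $$L(x,\lambda)=\begin{cases}J_1(x_1)+\mathbb{E}\big[J_2(x_1,x_2(\cdot))+\langle\lambda_e(\cdot),e(x_1,x_2(\cdot),\cdot)\rangle_{W^*,W}+\langle\lambda_i(\cdot),i(x_1,x_2(\cdot),\cdot)\rangle_{R^*,R}\big],&x\in X_0,\ \lambda\in\Lambda_0,\\-\infty,&x\in X_0,\ \lambda\notin\Lambda_0,\\ \infty,&x\notin X_0.\end{cases}$$ A saddle point of $L$ is a point $(\bar{x},\bar{\lambda})\in X\times\Lambda$ such that $L(\bar{x},\lambda)\le L(\bar{x},\bar{\lambda})\le L(x,\bar{\lambda})$ for all $(x,\lambda)\in X\times\Lambda$.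
   Formalization: J_1 and J_2 are each assumed convex, not only their sum J. With only J convex the claim fails: all spaces R, C_1={0}, C_2=R, K={0}, e=i=0, J_1=x_1^2, J_2=-x_1^2 has a saddle point at 0, but (ii) has no minimum. *)

theory Defs
  imports "HOL-Probability.Probability"
begin

section \<open>Reflexive Banach spaces\<close>

text \<open>
  A type class may not mention the type \<open>('a \<Rightarrow>\<^sub>L real) \<Rightarrow>\<^sub>L real\<close> in its own axiom, so membership in the
  dual and in the bidual is spelled out for plain functions; \<open>in_dual_iff\<close>, \<open>reflexive_blinfun\<close> and
  \<open>reflexive_banachI\<close> show that the class says exactly that the canonical embedding into the bidual
  \<open>('a \<Rightarrow>\<^sub>L real) \<Rightarrow>\<^sub>L real\<close> is onto.
\<close>

definition (in real_normed_vector) in_dual :: "('a \<Rightarrow> real) \<Rightarrow> bool" where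
  "in_dual f \<longleftrightarrow> (\<forall>x y. f (x + y) = f x + f y) \<and> (\<forall>c x. f (scaleR c x) = c * f x) \<and>
     (\<exists>k. \<forall>x. \<bar>f x\<bar> \<le> norm x * k)"

definition (in real_normed_vector) in_bidual :: "(('a \<Rightarrow> real) \<Rightarrow> real) \<Rightarrow> bool" where
  "in_bidual F \<longleftrightarrow>
     (\<forall>f g. in_dual f \<longrightarrow> in_dual g \<longrightarrow> F (\<lambda>x. f x + g x) = F f + F g) \<and>
     (\<forall>c f. in_dual f \<longrightarrow> F (\<lambda>x. c * f x) = c * F f) \<and>
     (\<exists>C. \<forall>f k. in_dual f \<longrightarrow> 0 \<le> k \<longrightarrow> (\<forall>x. \<bar>f x\<bar> \<le> k * norm x) \<longrightarrow> \<bar>F f\<bar> \<le> C * k)"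

class reflexive_banach = banach +
  assumes reflexive: "in_bidual F \<Longrightarrow> \<exists>x. \<forall>f. in_dual f \<longrightarrow> F f = f x"

lemma in_dual_iff: "in_dual f \<longleftrightarrow> bounded_linear f"
  by (auto simp: in_dual_def bounded_linear_def bounded_linear_axioms_def linear_iff)

lemma reflexive_blinfun:
  fixes F :: "('a::reflexive_banach \<Rightarrow>\<^sub>L real) \<Rightarrow>\<^sub>L real"
  shows "\<exists>x. \<forall>f. blinfun_apply F f = blinfun_apply f x"
proof -
  have "in_bidual (\<lambda>f. blinfun_apply F (Blinfun f))"
    unfolding in_bidual_def in_dual_iff
  proof (intro conjI allI impI)
    fix f g :: "'a \<Rightarrow> real" assume fg: "bounded_linear f" "bounded_linear g"
    then have "Blinfun (\<lambda>x. f x + g x) = Blinfun f + Blinfun g"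
      by (auto intro!: blinfun_eqI simp: blinfun.add_left bounded_linear_Blinfun_apply bounded_linear_add)
    then show "F (Blinfun (\<lambda>x. f x + g x)) = F (Blinfun f) + F (Blinfun g)"
      by (simp add: blinfun.add_right)
  next
    fix c :: real and f :: "'a \<Rightarrow> real" assume f: "bounded_linear f"
    then have "Blinfun (\<lambda>x. c * f x) = c *\<^sub>R Blinfun f"
      by (auto intro!: blinfun_eqI simp: blinfun.scaleR_left bounded_linear_Blinfun_apply bounded_linear_const_mult)
    then show "F (Blinfun (\<lambda>x. c * f x)) = c * F (Blinfun f)"
      by (simp add: blinfun.scaleR_right)
  next
    show "\<exists>C. \<forall>f k. bounded_linear f \<longrightarrow> 0 \<le> k \<longrightarrow> (\<forall>x. \<bar>f x\<bar> \<le> k * norm x) \<longrightarrow> \<bar>F (Blinfun f)\<bar> \<le> C * k"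
    proof (intro exI allI impI)
      fix f :: "'a \<Rightarrow> real" and k :: real
      assume f: "bounded_linear f" and k: "0 \<le> k" "\<forall>x. \<bar>f x\<bar> \<le> k * norm x"
      have "norm (Blinfun f) \<le> k"
        using f k by (intro norm_blinfun_bound) (auto simp: bounded_linear_Blinfun_apply)
      then show "\<bar>F (Blinfun f)\<bar> \<le> norm F * k"
        using norm_blinfun[of F "Blinfun f"] mult_left_mono[of "norm (Blinfun f)" k "norm F"] by simp
    qed
  qed
  from reflexive[OF this] obtain x where x: "\<And>f. bounded_linear f \<Longrightarrow> F (Blinfun f) = f x"
    by (auto simp: in_dual_iff)
  have "F f = f x" for f
    using x[OF blinfun.bounded_linear_right[of f]] by (simp add: blinfun_apply_inverse)
  then show ?thesis by blast
qed

lemma reflexive_banachI: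
  assumes "\<And>F :: ('a::banach \<Rightarrow>\<^sub>L real) \<Rightarrow>\<^sub>L real. \<exists>x. \<forall>f. blinfun_apply F f = blinfun_apply f x"
  shows "OFCLASS('a, reflexive_banach_class)"
proof
  fix G :: "('a \<Rightarrow> real) \<Rightarrow> real" assume G: "in_bidual G"
  then have "\<exists>C. \<forall>f k. bounded_linear f \<longrightarrow> 0 \<le> k \<longrightarrow> (\<forall>x. \<bar>f x\<bar> \<le> k * norm x) \<longrightarrow> \<bar>G f\<bar> \<le> C * k"
    by (simp only: in_bidual_def in_dual_iff)
  then obtain C where C: "\<forall>f k. bounded_linear f \<longrightarrow> 0 \<le> k \<longrightarrow> (\<forall>x. \<bar>f x\<bar> \<le> k * norm x) \<longrightarrow> \<bar>G f\<bar> \<le> C * k" ..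
  have bl: "bounded_linear (\<lambda>f. G (blinfun_apply f))"
  proof (rule bounded_linear_intro[where K = C])
    fix f g :: "'a \<Rightarrow>\<^sub>L real" and r :: real
    show "G (blinfun_apply (f + g)) = G (blinfun_apply f) + G (blinfun_apply g)"
      using G by (simp add: in_bidual_def in_dual_iff plus_blinfun.rep_eq blinfun.bounded_linear_right)
    show "G (blinfun_apply (r *\<^sub>R f)) = r *\<^sub>R G (blinfun_apply f)"
      using G by (simp add: in_bidual_def in_dual_iff scaleR_blinfun.rep_eq blinfun.bounded_linear_right)
    have "\<forall>x. \<bar>f x\<bar> \<le> norm f * norm x"
      using norm_blinfun[of f] by simp
    with C have "\<bar>G (blinfun_apply f)\<bar> \<le> C * norm f"
      using blinfun.bounded_linear_right[of f] norm_ge_zero[of f] by blast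
    then
    show "norm (G (blinfun_apply f)) \<le> norm f * C"
      by (simp add: mult.commute)
  qed
  obtain x where x: "\<And>f. Blinfun (\<lambda>f. G (blinfun_apply f)) f = blinfun_apply f x"
    using assms by blast
  have "G f = f x" if "in_dual f" for f
    using x[of "Blinfun f"] that bl by (simp add: in_dual_iff bounded_linear_Blinfun_apply)
  then show "\<exists>x. \<forall>f. in_dual f \<longrightarrow> G f = f x" by blast
qed


section \<open>Separability of the dual\<close>

text \<open>
  The Bochner integral of \<^theory>\<open>HOL-Analysis.Bochner_Integration\<close> needs a second countable
  range. For a reflexive separable space the dual is separable, which is made a class instance here,
  so that \<open>integrable\<close> and \<open>lebesgue_integral\<close> apply to functions into \<open>'a \<Rightarrow>\<^sub>L real\<close>.
\<close>

definition sublinear :: "('a::real_vector \<Rightarrow> real) \<Rightarrow> bool" where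
  "sublinear p \<longleftrightarrow> (\<forall>x y. p (x + y) \<le> p x + p y) \<and> (\<forall>c x. 0 \<le> c \<longrightarrow> p (c *\<^sub>R x) = c * p x)"

lemma sublinearD:
  assumes "sublinear p"
  shows "p (x + y) \<le> p x + p y" and "0 \<le> c \<Longrightarrow> p (c *\<^sub>R x) = c * p x" and "p 0 = 0" and "- p (- x) \<le> p x"
proof -
  show 1: "p (x + y) \<le> p x + p y" and "0 \<le> c \<Longrightarrow> p (c *\<^sub>R x) = c * p x" for x y c
    using assms by (auto simp: sublinear_def)
  from this(2)[of 0 0] show "p 0 = 0" by simp
  with 1[of x "- x"] show "- p (- x) \<le> p x" by simp
qed

lemma sublinearI:
  assumes add: "\<And>x y. p (x + y) \<le> p x + p y" and zero: "p 0 = 0"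
    and pos: "\<And>c x. 0 < c \<Longrightarrow> p (c *\<^sub>R x) \<le> c * p x"
  shows "sublinear p"
  unfolding sublinear_def
proof (intro conjI allI impI)
  fix c :: real and x assume "0 \<le> c"
  show "p (c *\<^sub>R x) = c * p x"
  proof (cases "c = 0")
    case False
    with \<open>0 \<le> c\<close> have c: "0 < c" by simp
    from pos[of "inverse c" "c *\<^sub>R x"] c have "p x \<le> inverse c * p (c *\<^sub>R x)" by simp
    then have "c * p x \<le> p (c *\<^sub>R x)" using c by (simp add: field_simps)
    with pos[OF c, of x] show ?thesis by simp
  qed (simp add: zero)
qed (rule add)

definition sublinear_shift :: "('a::real_vector \<Rightarrow> real) \<Rightarrow> 'a \<Rightarrow> 'a \<Rightarrow> real" where
  "sublinear_shift p y x = (INF t\<in>{0..}. p (x + t *\<^sub>R y) - t * p y)"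

lemma sublinear_shift:
  assumes p: "sublinear p"
  shows "sublinear (sublinear_shift p y)" "sublinear_shift p y x \<le> p x" "sublinear_shift p y (- y) \<le> - p y"
proof -
  let ?q = "sublinear_shift p y"
  have lb: "- p (- x) \<le> p (x + t *\<^sub>R y) - t * p y" if "0 \<le> t" for t x
    using sublinearD(1)[OF p, of "x + t *\<^sub>R y" "- x"] sublinearD(2)[OF p that, of y] by simp
  have bdd: "bdd_below ((\<lambda>t. p (x + t *\<^sub>R y) - t * p y) ` {0..})" for x
    using lb by (intro bdd_belowI2[where m = "- p (- x)"]) auto
  have le: "?q x \<le> p (x + t *\<^sub>R y) - t * p y" if "0 \<le> t" for t x
    unfolding sublinear_shift_def using that by (intro cINF_lower bdd) auto
  have ge: "m \<le> ?q x" if "\<And>t. 0 \<le> t \<Longrightarrow> m \<le> p (x + t *\<^sub>R y) - t * p y" for m x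
    unfolding sublinear_shift_def using that by (intro cINF_greatest) auto
  show q_le: "?q x \<le> p x" for x using le[of 0 x] by simp
  show "?q (- y) \<le> - p y" using le[of 1 "- y"] sublinearD(3)[OF p] by simp
  show "sublinear ?q"
  proof (rule sublinearI)
    fix x z
    have "?q (x + z) - ?q z \<le> p (x + s *\<^sub>R y) - s * p y" if s: "0 \<le> s" for s
    proof -
      have "?q (x + z) - (p (x + s *\<^sub>R y) - s * p y) \<le> ?q z"
      proof (rule ge)
        fix t :: real assume t: "0 \<le> t"
        have "?q (x + z) \<le> p ((x + s *\<^sub>R y) + (z + t *\<^sub>R y)) - (s + t) * p y"
          using le[of "s + t" "x + z"] s t by (simp add: algebra_simps)
        also have "\<dots> \<le> p (x + s *\<^sub>R y) + p (z + t *\<^sub>R y) - (s + t) * p y"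
          using sublinearD(1)[OF p] by simp
        finally show "?q (x + z) - (p (x + s *\<^sub>R y) - s * p y) \<le> p (z + t *\<^sub>R y) - t * p y"
          by (simp add: algebra_simps)
      qed
      then show ?thesis by simp
    qed
    from ge[OF this] show "?q (x + z) \<le> ?q x + ?q z" by simp
  next
    show "?q 0 = 0"
      using ge[of 0 0] le[of 0 0] sublinearD(2,3)[OF p] by (intro antisym) auto
  next
    fix c :: real and x assume c: "0 < c"
    have "?q (c *\<^sub>R x) / c \<le> ?q x"
    proof (rule ge)
      fix t :: real assume t: "0 \<le> t"
      have "?q (c *\<^sub>R x) \<le> p (c *\<^sub>R (x + t *\<^sub>R y)) - (c * t) * p y"
        using le[of "c * t" "c *\<^sub>R x"] c t by (simp add: algebra_simps)
      also have "\<dots> = c * (p (x + t *\<^sub>R y) - t * p y)"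
        using sublinearD(2)[OF p, of c "x + t *\<^sub>R y"] c by (simp add: right_diff_distrib)
      finally show "?q (c *\<^sub>R x) / c \<le> p (x + t *\<^sub>R y) - t * p y"
        using c by (simp add: field_simps)
    qed
    then show "?q (c *\<^sub>R x) \<le> c * ?q x" using c by (simp add: field_simps)
  qed
qed

text \<open>Hahn--Banach: a minimal sublinear functional below \<open>p\<close> is linear.\<close>

lemma hahn_banach_sublinear:
  fixes p :: "'a::real_vector \<Rightarrow> real"
  assumes p: "sublinear p"
  obtains F where "linear F" "\<And>x. F x \<le> p x" "F x0 = p x0"
proof -
  let ?p0 = "sublinear_shift p x0"
  define A where "A = {q. sublinear q \<and> (\<forall>x. q x \<le> ?p0 x)}"
  define P where "P = (\<lambda>q r :: 'a \<Rightarrow> real. \<forall>x. r x \<le> q x)"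
  have p0A: "?p0 \<in> A" using sublinear_shift(1)[OF p] by (simp add: A_def)
  have po: "partial_order_on A (relation_of P A)"
    by (rule partial_order_on_relation_ofI)
      (auto simp: P_def fun_eq_iff intro: order_trans antisym)
  have "\<exists>m\<in>A. \<forall>a\<in>A. P m a \<longrightarrow> a = m"
  proof (rule predicate_Zorn[OF po])
    fix C assume C: "C \<in> Chains (relation_of P A)"
    have CA: "C \<subseteq> A" using C by (auto simp: Chains_def relation_of_def)
    have tot: "P q r \<or> P r q" if "q \<in> C" "r \<in> C" for q r
      using C that by (auto simp: Chains_def relation_of_def)
    show "\<exists>u\<in>A. \<forall>a\<in>C. P a u"
    proof (cases "C = {}")
      case True then show ?thesis using p0A by auto
    next
      case False
      define u where "u = (\<lambda>x. INF q\<in>C. q x)"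
      have lb: "- ?p0 (- x) \<le> q x" if "q \<in> C" for q x
      proof -
        have q: "sublinear q" "q (- x) \<le> ?p0 (- x)" using that CA by (auto simp: A_def)
        from sublinearD(4)[OF q(1), of x] q(2) show ?thesis by linarith
      qed
      have le: "u x \<le> q x" if "q \<in> C" for q x
        unfolding u_def using that lb by (intro cINF_lower bdd_belowI2[where m = "- ?p0 (- x)"]) auto
      have ge: "m \<le> u x" if "\<And>q. q \<in> C \<Longrightarrow> m \<le> q x" for m x
        unfolding u_def using that False by (intro cINF_greatest) auto
      have "sublinear u"
      proof (rule sublinearI)
        fix x y
        have "u (x + y) - u y \<le> q x" if q: "q \<in> C" for q
        proof -
          have "u (x + y) - q x \<le> u y"
          proof (rule ge)
            fix r assume r: "r \<in> C"
            have qr: "sublinear q" "sublinear r" using q r CA by (auto simp: A_def)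
            from tot[OF q r] show "u (x + y) - q x \<le> r y"
            proof
              assume "P q r"
              then have "r x \<le> q x" by (simp add: P_def)
              with le[OF r, of "x + y"] sublinearD(1)[OF qr(2), of x y] show ?thesis by linarith
            next
              assume "P r q"
              then have "q y \<le> r y" by (simp add: P_def)
              with le[OF q, of "x + y"] sublinearD(1)[OF qr(1), of x y] show ?thesis by linarith
            qed
          qed
          then show ?thesis by simp
        qed
        then have "u (x + y) - u y \<le> u x" by (rule ge)
        then show "u (x + y) \<le> u x + u y" by simp
      next
        have "q 0 = 0" if "q \<in> C" for q
          using that CA sublinearD(3) by (auto simp: A_def)
        then show "u 0 = 0" unfolding u_def using False by (subst INF_cong[OF refl, where D = "\<lambda>_. 0"]) auto
      next
        fix c :: real and x assume c: "0 < c"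
        have "u (c *\<^sub>R x) / c \<le> u x"
        proof (rule ge)
          fix q assume q: "q \<in> C"
          then have "sublinear q" using CA by (auto simp: A_def)
          from sublinearD(2)[OF this, of c x] le[OF q, of "c *\<^sub>R x"] c
          show "u (c *\<^sub>R x) / c \<le> q x" by (simp add: field_simps)
        qed
        then show "u (c *\<^sub>R x) \<le> c * u x" using c by (simp add: field_simps)
      qed
      moreover obtain q where q: "q \<in> C" using False by auto
      have "u x \<le> ?p0 x" for x
      proof -
        have "q x \<le> ?p0 x" using q CA by (auto simp: A_def)
        with le[OF q, of x] show ?thesis by linarith
      qed
      ultimately have "u \<in> A" by (simp add: A_def)
      moreover have "\<forall>a\<in>C. P a u" using le by (simp add: P_def)
      ultimately show ?thesis by blast
    qed
  qed
  then obtain F where F: "F \<in> A" and min: "\<And>q. q \<in> A \<Longrightarrow> P F q \<Longrightarrow> q = F" by blast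
  have sF: "sublinear F" and Fp0: "\<And>x. F x \<le> ?p0 x" using F by (auto simp: A_def)
  have odd: "F (- y) = - F y" for y
  proof -
    have "sublinear_shift F y \<in> A"
      unfolding A_def using sublinear_shift(1,2)[OF sF] Fp0 order_trans by blast
    then have "sublinear_shift F y = F"
      by (rule min) (simp add: P_def sublinear_shift(2)[OF sF])
    with sublinear_shift(3)[OF sF, of y] sublinearD(4)[OF sF, of y] show ?thesis by simp
  qed
  have "linear F"
  proof (rule linearI)
    fix x y
    have "F (- (x + y)) \<le> F (- x) + F (- y)" using sublinearD(1)[OF sF, of "- x" "- y"] by simp
    then have "F x + F y \<le> F (x + y)" by (simp only: odd)
    with sublinearD(1)[OF sF, of x y] show "F (x + y) = F x + F y" by simp
  next
    fix c :: real and x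
    show "F (c *\<^sub>R x) = c *\<^sub>R F x"
    proof (cases "0 \<le> c")
      case True then show ?thesis using sublinearD(2)[OF sF] by simp
    next
      case False
      then have "F (- (c *\<^sub>R x)) = - c * F x" using sublinearD(2)[OF sF, of "- c" x] by simp
      then show ?thesis by (simp add: odd)
    qed
  qed
  moreover have Fp: "F x \<le> p x" for x
    using Fp0[of x] sublinear_shift(2)[OF p, of x0 x] by linarith
  moreover have "F x0 = p x0"
    using Fp0[of "- x0"] sublinear_shift(3)[OF p, of x0] Fp[of x0] by (simp add: odd)
  ultimately show thesis using that by blast
qed

lemma hahn_banach_subspace:
  fixes S :: "'a::real_normed_vector set"
  assumes S: "subspace S" and x0: "x0 \<notin> closure S"
  obtains F :: "'a \<Rightarrow>\<^sub>L real" where "\<And>x. x \<in> S \<Longrightarrow> F x = 0" "F x0 \<noteq> 0"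
proof -
  have ne: "S \<noteq> {}" and 0: "0 \<in> S" using S subspace_0 by auto
  let ?p = "\<lambda>x. infdist x S"
  have near: "\<exists>s\<in>S. dist x s < infdist x S + e" if "0 < e" for x e
  proof (rule ccontr)
    assume "\<not> ?thesis"
    then have "infdist x S + e \<le> infdist x S"
      unfolding infdist_notempty[OF ne] by (intro cINF_greatest[OF ne]) (auto simp: not_less infdist_notempty[OF ne])
    with that show False by simp
  qed
  have p: "sublinear ?p"
  proof (rule sublinearI)
    fix x y
    show "?p (x + y) \<le> ?p x + ?p y"
    proof (rule field_le_epsilon)
      fix e :: real assume e: "0 < e"
      obtain s where s: "s \<in> S" "dist x s < ?p x + e / 2" using near[of "e / 2" x] e by auto
      obtain t where t: "t \<in> S" "dist y t < ?p y + e / 2" using near[of "e / 2" y] e by auto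
      have "?p (x + y) \<le> dist (x + y) (s + t)" using S s t by (intro infdist_le) (auto simp: subspace_add)
      also have "\<dots> \<le> dist x s + dist y t" by (rule dist_triangle_add)
      finally show "?p (x + y) \<le> ?p x + ?p y + e" using s t by simp
    qed
  next
    show "?p 0 = 0" using 0 by simp
  next
    fix c :: real and x assume c: "0 < c"
    show "?p (c *\<^sub>R x) \<le> c * ?p x"
    proof (rule field_le_epsilon)
      fix e :: real assume e: "0 < e"
      obtain s where s: "s \<in> S" "dist x s < ?p x + e / c" using near[of "e / c" x] e c by auto
      have "?p (c *\<^sub>R x) \<le> dist (c *\<^sub>R x) (c *\<^sub>R s)" using S s by (intro infdist_le) (auto simp: subspace_scale)
      also have "\<dots> = c * dist x s" using c by (simp add: dist_norm flip: scaleR_diff_right)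
      also have "\<dots> \<le> c * (?p x + e / c)" using s c by (intro mult_left_mono) auto
      finally show "?p (c *\<^sub>R x) \<le> c * ?p x + e" using c by (simp add: algebra_simps)
    qed
  qed
  obtain F where F: "linear F" "\<And>x. F x \<le> ?p x" "F x0 = ?p x0"
    using hahn_banach_sublinear[OF p] by blast
  have le: "F x \<le> norm x" for x
    using F(2)[of x] infdist_le[OF 0, of x] by simp
  have bl: "bounded_linear F"
  proof (rule bounded_linear_intro[where K = 1])
    fix x
    show "norm (F x) \<le> norm x * 1"
      using le[of x] le[of "- x"] linear_neg[OF F(1), of x] by (simp add: abs_le_iff)
  qed (simp_all add: linear_add[OF F(1)] linear_scale[OF F(1)])
  have "F x = 0" if "x \<in> S" for x
  proof -
    have "F x \<le> 0" "F (- x) \<le> 0"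
      using F(2)[of x] F(2)[of "- x"] that subspace_neg[OF S that] by auto
    then show ?thesis using linear_neg[OF F(1), of x] by simp
  qed
  moreover have "F x0 \<noteq> 0"
    using F(3) x0 in_closure_iff_infdist_zero[OF ne, of x0] by simp
  ultimately show thesis
    using that[of "Blinfun F"] bl by (simp add: bounded_linear_Blinfun_apply)
qed

lemma dual_separable:
  "\<exists>D :: ('a::{reflexive_banach, second_countable_topology} \<Rightarrow>\<^sub>L real) set. countable D \<and> closure D = UNIV"
proof -
  obtain B :: "'a set" where B: "countable B" "\<And>U. open U \<Longrightarrow> U \<noteq> {} \<Longrightarrow> \<exists>d\<in>B. d \<in> U"
    using countable_dense_exists by blast
  define J :: "'a \<Rightarrow> ('a \<Rightarrow>\<^sub>L real) \<Rightarrow>\<^sub>L real" where "J = (\<lambda>x. Blinfun (\<lambda>f. blinfun_apply f x))"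
  have J: "J x f = f x" for x f
    by (simp add: J_def bounded_linear_Blinfun_apply blinfun.bounded_linear_left)
  have Jdiff: "J x - J y = J (x - y)" for x y
    by (intro blinfun_eqI) (simp add: J blinfun.diff_left blinfun.diff_right)
  have Jle: "norm (J x) \<le> norm x" for x
    by (rule norm_blinfun_bound) (use norm_blinfun in \<open>auto simp: J mult.commute simp del: real_norm_def\<close>)
  have ex: "\<exists>f. norm f \<le> 1 \<and> norm (J x) / 2 \<le> blinfun_apply f x" for x
  proof (rule ccontr)
    assume H: "\<not> ?thesis"
    have less: "\<bar>blinfun_apply f x\<bar> \<le> norm (J x) / 2" if "norm f \<le> 1" for f
    proof -
      have "f x \<le> norm (J x) / 2" "(- f) x \<le> norm (J x) / 2"
        using H that by (auto simp del: blinfun.minus_left) (metis linear norm_minus_cancel)+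
      then show ?thesis by (simp add: blinfun.minus_left abs_le_iff)
    qed
    have "norm (J x) \<le> norm (J x) / 2"
    proof (rule norm_blinfun_bound)
      fix f :: "'a \<Rightarrow>\<^sub>L real"
      show "norm (J x f) \<le> norm (J x) / 2 * norm f"
      proof (cases "f = 0")
        case False
        from less[of "inverse (norm f) *\<^sub>R f"] False show ?thesis
          by (simp add: J blinfun.scaleR_left abs_mult field_simps)
      qed (simp add: J)
    qed simp
    then have "norm (J x) = 0" by simp
    with H show False by (auto dest!: spec[of _ 0])
  qed
  then obtain \<phi> :: "'a \<Rightarrow> 'a \<Rightarrow>\<^sub>L real" where \<phi>: "\<And>x. norm (\<phi> x) \<le> 1" "\<And>x. norm (J x) / 2 \<le> \<phi> x x" by metis
  define Q where "Q = (\<lambda>l. \<Sum>(q, x)\<leftarrow>l. real_of_rat q *\<^sub>R \<phi> x) ` lists (UNIV \<times> B)"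
  have Qc: "countable Q" unfolding Q_def using B(1) by (intro countable_image countable_lists countable_SIGMA) auto
  have Q0: "0 \<in> Q" by (auto simp: Q_def intro!: image_eqI[of _ _ "[]"])
  have Qadd: "real_of_rat q *\<^sub>R \<phi> x + y \<in> Q" if "x \<in> B" "y \<in> Q" for q x y
    using that by (auto simp: Q_def intro!: image_eqI[of _ _ "(q, x) # _"])
  have span_Q: "span (\<phi> ` B) \<subseteq> closure Q"
  proof
    fix y assume "y \<in> span (\<phi> ` B)"
    then show "y \<in> closure Q"
    proof (induction rule: span_induct_alt)
      case base show ?case using Q0 closure_subset by blast
    next
      case (step c z y)
      obtain x where x: "x \<in> B" "z = \<phi> x" using step by auto
      show ?case unfolding closure_approachable
      proof (intro allI impI)
        fix e :: real assume e: "0 < e"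
        obtain y' where y': "y' \<in> Q" "dist y' y < e / 2"
          using step e unfolding closure_approachable by (meson half_gt_zero)
        obtain q where q: "c < real_of_rat q" "real_of_rat q < c + e / 2"
          using of_rat_dense[of c "c + e / 2"] e by auto
        have "dist (real_of_rat q *\<^sub>R \<phi> x + y') (c *\<^sub>R z + y) \<le> dist (real_of_rat q *\<^sub>R \<phi> x) (c *\<^sub>R z) + dist y' y"
          by (rule dist_triangle_add)
        also have "dist (real_of_rat q *\<^sub>R \<phi> x) (c *\<^sub>R z) = \<bar>real_of_rat q - c\<bar> * norm (\<phi> x)"
          by (simp add: x dist_norm flip: scaleR_diff_left)
        also have "\<dots> \<le> \<bar>real_of_rat q - c\<bar> * 1" by (intro mult_left_mono \<phi>(1)) simp
        finally have "dist (real_of_rat q *\<^sub>R \<phi> x + y') (c *\<^sub>R z + y) < e" using q y' by simp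
        then show "\<exists>w\<in>Q. dist w (c *\<^sub>R z + y) < e" using Qadd[OF x(1) y'(1)] by blast
      qed
    qed
  qed
  have "closure (span (\<phi> ` B)) = UNIV"
  proof (rule ccontr)
    assume "closure (span (\<phi> ` B)) \<noteq> UNIV"
    then obtain f0 where "f0 \<notin> closure (span (\<phi> ` B))" by auto
    then obtain F :: "('a \<Rightarrow>\<^sub>L real) \<Rightarrow>\<^sub>L real" where F: "\<And>f. f \<in> span (\<phi> ` B) \<Longrightarrow> F f = 0" "F f0 \<noteq> 0"
      using hahn_banach_subspace[OF subspace_span] by blast
    obtain x where "\<forall>f. F f = blinfun_apply f x" using reflexive_blinfun by blast
    then have Fx: "F = J x" by (intro blinfun_eqI) (simp add: J)
    have pos: "0 < norm F" using F(2) by auto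
    obtain b where b: "b \<in> B" "dist x b < norm F / 4"
      using B(2)[of "ball x (norm F / 4)"] pos by auto
    have small: "norm (J b - F) < norm F / 4"
      using Jle[of "b - x"] b by (simp add: Fx Jdiff dist_norm norm_minus_commute)
    have "norm (J b) / 2 \<le> \<phi> b b" by (rule \<phi>)
    also have "\<dots> = (J b - F) (\<phi> b)" using F(1)[of "\<phi> b"] b by (simp add: J blinfun.diff_left span_base)
    also have "\<dots> \<le> norm (J b - F) * norm (\<phi> b)" using norm_blinfun[of "J b - F" "\<phi> b"] by simp
    also have "\<dots> \<le> norm (J b - F) * 1" by (intro mult_left_mono \<phi>(1)) simp
    finally have "norm (J b) \<le> 2 * norm (J b - F)" by simp
    moreover have "norm F - norm (J b) \<le> norm (J b - F)"
      using norm_triangle_ineq2[of F "J b"] by (simp add: norm_minus_commute)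
    ultimately show False using small pos by linarith
  qed
  then have "closure Q = UNIV"
    using closure_minimal[OF span_Q closed_closure] by auto
  with Qc show ?thesis by blast
qed

lemma dense_imp_countable_subbasis:
  fixes D :: "'a::metric_space set"
  assumes D: "countable D" "closure D = UNIV"
  shows "\<exists>B :: 'a set set. countable B \<and> open = generate_topology B"
proof -
  let ?B = "(\<lambda>(d, n). ball d (inverse (real (Suc n)))) ` (D \<times> UNIV)"
  have "topological_basis ?B"
  proof (rule topological_basisI)
    fix U :: "'a set" and x assume "open U" "x \<in> U"
    then obtain e where e: "0 < e" "ball x e \<subseteq> U" by (auto simp: open_contains_ball)
    obtain n where n: "inverse (real (Suc n)) < e / 2" using reals_Archimedean[of "e / 2"] e by auto
    obtain d where d: "d \<in> D" "dist d x < inverse (real (Suc n))"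
      using D(2) closure_approachable[of x D] by (metis UNIV_I inverse_positive_iff_positive of_nat_0_less_iff zero_less_Suc)
    have "ball d (inverse (real (Suc n))) \<subseteq> ball x e"
    proof
      fix y assume "y \<in> ball d (inverse (real (Suc n)))"
      then have "dist d y < inverse (real (Suc n))" by simp
      with dist_triangle[of x y d] d(2) n show "y \<in> ball x e" by (simp add: dist_commute)
    qed
    with d e show "\<exists>B'\<in>?B. x \<in> B' \<and> B' \<subseteq> U" by (intro bexI[of _ "ball d (inverse (real (Suc n)))"]) auto
  qed auto
  moreover have "countable ?B" using D(1) by (intro countable_image countable_SIGMA) auto
  ultimately show ?thesis
    by (intro exI[of _ ?B]) (auto simp: topological_basis_imp_subbasis)
qed

instance blinfun :: ("{reflexive_banach, second_countable_topology}", euclidean_space) second_countable_topology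
proof
  obtain D :: "('a \<Rightarrow>\<^sub>L real) set" where D: "countable D" "closure D = UNIV"
    using dual_separable by blast
  define Z :: "('b \<Rightarrow> 'a \<Rightarrow>\<^sub>L real) \<Rightarrow> 'a \<Rightarrow>\<^sub>L 'b"
    where "Z = (\<lambda>g. \<Sum>b\<in>Basis. blinfun_scaleR_left b o\<^sub>L g b)"
  have "closure (Z ` (Basis \<rightarrow>\<^sub>E D)) = UNIV"
  proof (intro set_eqI iffI UNIV_I)
    fix f :: "'a \<Rightarrow>\<^sub>L 'b"
    show "f \<in> closure (Z ` (Basis \<rightarrow>\<^sub>E D))" unfolding closure_approachable
    proof (intro allI impI)
      fix e :: real assume e: "0 < e"
      define h where "h = (\<lambda>b. blinfun_inner_left b o\<^sub>L f)"
      define e' where "e' = e / (real DIM('b) + 1)"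
      have e': "0 < e'" using e by (simp add: e'_def add_pos_nonneg)
      have "\<forall>b. \<exists>g\<in>D. dist g (h b) < e'" using D(2) e' closure_approachable by blast
      then obtain g where g: "\<And>b. g b \<in> D" "\<And>b. dist (g b) (h b) < e'" by metis
      have f: "f = Z h"
        by (intro blinfun_eqI) (simp add: Z_def h_def blinfun.sum_left inner_commute[of _ "blinfun_apply f _"] euclidean_representation)
      have "dist (Z (restrict g Basis)) f = norm (\<Sum>b\<in>Basis. blinfun_scaleR_left b o\<^sub>L (g b - h b))"
      proof -
        have "Z (restrict g Basis) - Z h = (\<Sum>b\<in>Basis. blinfun_scaleR_left b o\<^sub>L (g b - h b))"
          by (intro blinfun_eqI)
            (simp add: Z_def blinfun.diff_left blinfun.sum_left scaleR_diff_left sum_subtractf)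
        then show ?thesis by (subst f) (simp add: dist_norm)
      qed
      also have "\<dots> \<le> (\<Sum>b\<in>(Basis :: 'b set). e')"
      proof (rule sum_norm_le)
        fix b :: 'b assume b: "b \<in> Basis"
        have "norm (blinfun_scaleR_left b o\<^sub>L (g b - h b)) \<le> norm (g b - h b)"
        proof (rule norm_blinfun_bound)
          show "norm ((blinfun_scaleR_left b o\<^sub>L (g b - h b)) x) \<le> norm (g b - h b) * norm x" for x
            using norm_blinfun[of "g b - h b" x] b by simp
        qed simp
        also have "\<dots> \<le> e'" using g(2)[of b] by (simp add: dist_norm)
        finally show "norm (blinfun_scaleR_left b o\<^sub>L (g b - h b)) \<le> e'" .
      qed
      also have "\<dots> < e" using e by (simp add: e'_def field_simps)
      finally show "\<exists>y\<in>Z ` (Basis \<rightarrow>\<^sub>E D). dist y f < e"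
        using g(1) by (auto intro!: bexI[of _ "restrict g Basis"])
    qed
  qed
  moreover have "countable (Z ` (Basis \<rightarrow>\<^sub>E D))"
    using D(1) by (intro countable_image countable_PiE) auto
  ultimately show "\<exists>B :: ('a \<Rightarrow>\<^sub>L 'b) set set. countable B \<and> open = generate_topology B"
    by (intro dense_imp_countable_subbasis)
qed


section \<open>The stochastic optimization problem\<close>

definition cone_le :: "'r::real_vector set \<Rightarrow> 'r \<Rightarrow> 'r \<Rightarrow> bool" where
  "cone_le K r r' \<longleftrightarrow> r' - r \<in> K"

definition cone_convex :: "'r::real_vector set \<Rightarrow> ('x::real_vector \<Rightarrow> 'r) \<Rightarrow> bool" where
  "cone_convex K f \<longleftrightarrow> (\<forall>x y. \<forall>t\<in>{0<..<1}.
     cone_le K (f (t *\<^sub>R x + (1 - t) *\<^sub>R y)) (t *\<^sub>R f x + (1 - t) *\<^sub>R f y))"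

definition dual_cone :: "'r::real_normed_vector set \<Rightarrow> ('r \<Rightarrow>\<^sub>L real) set" where
  "dual_cone K = {rs. \<forall>r\<in>K. blinfun_apply rs r \<ge> 0}"

text \<open>
  Elements of \<open>L\<^sup>\<infinity>\<close> and \<open>L\<^sup>1\<close> are represented by functions rather than by their almost-everywhere
  classes. For separable ranges, Borel measurability is strong (Bochner) measurability, and
  membership in \<open>L\<^sup>1\<close> is \<^term>\<open>integrable M\<close>.
\<close>

definition L_infinity :: "'m measure \<Rightarrow> ('m \<Rightarrow> 'x::{banach, second_countable_topology}) set" where
  "L_infinity M = {f \<in> borel_measurable M. \<exists>c. AE \<omega> in M. norm (f \<omega>) \<le> c}"

text \<open>
  Convexity of \<open>J(x1, x2) = J1(x1) + J2(x1, x2)\<close> is required of both summands. If only the sum is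
  convex, the optimality conditions are not necessary: for real \<open>x1\<close>, \<open>J1(x1) = x1^2\<close>,
  \<open>J2(x1, x2) = - x1^2\<close>, \<open>C1 = {0}\<close> and vanishing \<open>e\<close>, \<open>i\<close>, the origin is a saddle point, but
  \<open>- x1^2 - \<rho> x1\<close> has no minimum over the reals.
\<close>

definition basic_assumption ::
  "'m measure \<Rightarrow> 'x1::{banach, second_countable_topology} set \<Rightarrow> 'x2::{banach, second_countable_topology} set \<Rightarrow>
   'r::{banach, second_countable_topology} set \<Rightarrow> ('x1 \<Rightarrow> real) \<Rightarrow> ('x1 \<Rightarrow> 'x2 \<Rightarrow> real) \<Rightarrow>
   ('x1 \<Rightarrow> 'x2 \<Rightarrow> 'm \<Rightarrow> 'w::{banach, second_countable_topology}) \<Rightarrow> ('x1 \<Rightarrow> 'x2 \<Rightarrow> 'm \<Rightarrow> 'r) \<Rightarrow> bool" where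
  "basic_assumption M C1 C2 K J1 J2 e i \<longleftrightarrow>
     C1 \<noteq> {} \<and> closed C1 \<and> convex C1 \<and>
     C2 \<noteq> {} \<and> closed C2 \<and> convex C2 \<and>
     K \<noteq> {} \<and> closed K \<and> convex K \<and> cone K \<and>
     convex_on UNIV J1 \<and> convex_on UNIV (\<lambda>(x1, x2). J2 x1 x2) \<and>
     (\<forall>r>0. \<exists>a>0. \<forall>x1 x2. norm x1 + norm x2 \<le> r \<longrightarrow> \<bar>J2 x1 x2\<bar> \<le> a) \<and>
     (\<forall>\<omega>\<in>space M. linear (\<lambda>(x1, x2). e x1 x2 \<omega>) \<and> continuous_on UNIV (\<lambda>(x1, x2). e x1 x2 \<omega>)) \<and>
     (\<forall>\<omega>\<in>space M. cone_convex K (\<lambda>(x1, x2). i x1 x2 \<omega>) \<and> continuous_on UNIV (\<lambda>(x1, x2). i x1 x2 \<omega>)) \<and>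
     (\<forall>x1 x2. e x1 x2 \<in> borel_measurable M \<and> i x1 x2 \<in> borel_measurable M) \<and>
     (\<forall>r>0. \<exists>b>0. \<forall>x1 x2. norm x1 + norm x2 \<le> r \<longrightarrow> (AE \<omega> in M. norm (e x1 x2 \<omega>) \<le> b)) \<and>
     (\<forall>r>0. \<exists>b>0. \<forall>x1 x2. norm x1 + norm x2 \<le> r \<longrightarrow> (AE \<omega> in M. norm (i x1 x2 \<omega>) \<le> b))"

definition X_space :: "'m measure \<Rightarrow> ('x1 \<times> ('m \<Rightarrow> 'x2::{banach, second_countable_topology})) set" where
  "X_space M = UNIV \<times> L_infinity M"

definition Lambda_space ::
  "'m measure \<Rightarrow> (('m \<Rightarrow> 'w::{reflexive_banach, second_countable_topology} \<Rightarrow>\<^sub>L real) \<times>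
     ('m \<Rightarrow> 'r::{reflexive_banach, second_countable_topology} \<Rightarrow>\<^sub>L real)) set" where
  "Lambda_space M = {le. integrable M le} \<times> {li. integrable M li}"

definition X0_set ::
  "'m measure \<Rightarrow> 'x1 set \<Rightarrow> 'x2 set \<Rightarrow> ('x1 \<times> ('m \<Rightarrow> 'x2::{banach, second_countable_topology})) set" where
  "X0_set M C1 C2 = {(x1, x2) \<in> X_space M. x1 \<in> C1 \<and> (AE \<omega> in M. x2 \<omega> \<in> C2)}"

definition Lambda0_set ::
  "'m measure \<Rightarrow> 'r set \<Rightarrow> (('m \<Rightarrow> 'w::{reflexive_banach, second_countable_topology} \<Rightarrow>\<^sub>L real) \<times>
     ('m \<Rightarrow> 'r::{reflexive_banach, second_countable_topology} \<Rightarrow>\<^sub>L real)) set" where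
  "Lambda0_set M K = {(le, li) \<in> Lambda_space M. AE \<omega> in M. li \<omega> \<in> dual_cone K}"

definition lagrangian ::
  "'m measure \<Rightarrow> 'x1 set \<Rightarrow> 'x2 set \<Rightarrow> 'r set \<Rightarrow> ('x1 \<Rightarrow> real) \<Rightarrow> ('x1 \<Rightarrow> 'x2 \<Rightarrow> real) \<Rightarrow>
   ('x1 \<Rightarrow> 'x2 \<Rightarrow> 'm \<Rightarrow> 'w) \<Rightarrow> ('x1 \<Rightarrow> 'x2 \<Rightarrow> 'm \<Rightarrow> 'r) \<Rightarrow>
   'x1 \<times> ('m \<Rightarrow> 'x2::{banach, second_countable_topology}) \<Rightarrow>
   ('m \<Rightarrow> 'w::{reflexive_banach, second_countable_topology} \<Rightarrow>\<^sub>L real) \<times>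
   ('m \<Rightarrow> 'r::{reflexive_banach, second_countable_topology} \<Rightarrow>\<^sub>L real) \<Rightarrow> ereal" where
  "lagrangian M C1 C2 K J1 J2 e i = (\<lambda>(x1, x2) (le, li).
     if (x1, x2) \<notin> X0_set M C1 C2 then \<infinity>
     else if (le, li) \<notin> Lambda0_set M K then - \<infinity>
     else ereal (J1 x1 + (LINT \<omega>|M. J2 x1 (x2 \<omega>) + blinfun_apply (le \<omega>) (e x1 (x2 \<omega>) \<omega>)
                                       + blinfun_apply (li \<omega>) (i x1 (x2 \<omega>) \<omega>))))"

definition saddle_point :: "'x set \<Rightarrow> 'l set \<Rightarrow> ('x \<Rightarrow> 'l \<Rightarrow> ereal) \<Rightarrow> 'x \<Rightarrow> 'l \<Rightarrow> bool" where
  "saddle_point X \<Lambda> L xbar lbar \<longleftrightarrow> xbar \<in> X \<and> lbar \<in> \<Lambda> \<and>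
     (\<forall>x\<in>X. \<forall>l\<in>\<Lambda>. L xbar l \<le> L xbar lbar \<and> L xbar lbar \<le> L x lbar)"

end

theory Submission
  imports Defs "HOL-Library.Function_Algebras"
begin

text \<open>
  Testing the saddle point inequality in \<open>\<lambda>\<close> with \<open>indicator A *\<^sub>R t\<close>, for \<open>t\<close> in a countable dense
  subset of the dual cone, gives the constraints by the bipolar theorem. Testing it in \<open>x\<close> says that
  \<open>(x1, x2)\<close> minimizes \<open>J1 x1 + E[\<phi> (x1, x2(\<omega>)) \<omega>]\<close>. Replace \<open>x1\<close> under the expectation by \<open>x1 + v(\<omega>)\<close>,
  with \<open>v\<close> in \<open>L\<^sup>\<infinity>\<close>; the infimum over \<open>(x1, x2)\<close> is then convex in \<open>v\<close>, and Hahn--Banach yields a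
  subgradient \<open>G\<close> at \<open>v = 0\<close>. Since \<open>\<phi>\<close> is dominated by an integrable function on bounded sets,
  \<open>G (indicator A *\<^sub>R x) \<le> norm x * \<integral>\<^bsub>A\<^esub> c\<close> for some integrable \<open>c\<close>. So \<open>G\<close> has no singular part and is given
  by a density \<open>\<rho>\<close> with values in the separable dual. The subgradient inequality now decouples into a
  minimization in \<open>x1\<close> and, by localization to sets \<open>A\<close>, a pointwise minimization. The converse
  follows by integrating the pointwise inequality.
\<close>

section \<open>Subgradients of marginal functions\<close>

text \<open>Perturbations are plain functions on the sample space. With a vector space structure on
  the function type, \<open>subspace\<close> and \<open>hahn_banach_sublinear\<close> apply to
  them.\<close>

instantiation "fun" :: (type, real_vector) real_vector
begin

definition scaleR_fun :: "real \<Rightarrow> ('a \<Rightarrow> 'b) \<Rightarrow> 'a \<Rightarrow> 'b" where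
  "scaleR_fun c f = (\<lambda>x. c *\<^sub>R f x)"

instance
  by standard (simp_all add: scaleR_fun_def fun_eq_iff scaleR_add_right scaleR_add_left)

end

text \<open>
  The Hahn--Banach lemma \<open>hahn_banach_sublinear\<close> speaks about functionals on a whole type, while the
  perturbations form a subspace; composing with a projection bridges the gap.
\<close>

lemma linear_projection_onto_subspace:
  fixes S :: "'v::real_vector set"
  assumes "subspace S"
  obtains \<pi> where "linear \<pi>" "\<And>v. \<pi> v \<in> S" "\<And>v. v \<in> S \<Longrightarrow> \<pi> v = v"
proof -
  interpret vector_space_pair "scaleR :: real \<Rightarrow> 'v \<Rightarrow> 'v" "scaleR :: real \<Rightarrow> 'v \<Rightarrow> 'v" ..
  show thesis
    using linear_exists_left_inverse_on[OF linear_ident assms] that by (auto simp: image_subset_iff)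
qed

text \<open>The \<open>p\<close> of the proof is the one-sided directional derivative at 0 of the
  convex marginal v |-> inf over x of \<open>\<Psi> x v\<close>, and a linear functional below it is
  a subgradient. Joint convexity is phrased with some witness \<open>z\<close>, so that
  \<open>'x\<close> may be any type. The functional \<open>G\<close> is linear only; its boundedness
  has to come from elsewhere.\<close>

lemma subgradient_of_marginal:
  fixes \<Psi> :: "'x \<Rightarrow> 'v::real_vector \<Rightarrow> real"
  assumes S: "subspace S" and xb: "xb \<in> X" and min: "\<And>x. x \<in> X \<Longrightarrow> \<Psi> xb 0 \<le> \<Psi> x 0"
    and conv: "\<And>x y v w a b. \<lbrakk>x \<in> X; y \<in> X; v \<in> S; w \<in> S; 0 < a; 0 < b; a + b = 1\<rbrakk> \<Longrightarrow>
      \<exists>z\<in>X. \<Psi> z (a *\<^sub>R v + b *\<^sub>R w) \<le> a * \<Psi> x v + b * \<Psi> y w"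
  obtains G where "linear G" "\<And>x v. x \<in> X \<Longrightarrow> v \<in> S \<Longrightarrow> \<Psi> xb 0 + G v \<le> \<Psi> x v"
proof -
  obtain \<pi> where \<pi>: "linear \<pi>" "\<And>v. \<pi> v \<in> S" "\<And>v. v \<in> S \<Longrightarrow> \<pi> v = v"
    using linear_projection_onto_subspace[OF S] by blast
  have \<pi>_add: "\<pi> (v + w) = \<pi> v + \<pi> w" and \<pi>_scale: "\<pi> (c *\<^sub>R v) = c *\<^sub>R \<pi> v" for v w c
    using linear_add[OF \<pi>(1)] linear_scale[OF \<pi>(1)] by auto
  define m where "m = \<Psi> xb 0"
  \<comment> \<open>\<open>q\<close> is the difference quotient with step \<open>t\<close>; by
    \<open>min\<close>, \<open>m\<close> is the value of the marginal at 0. Taking the infimum over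
    \<open>t\<close> and \<open>x\<close> together avoids forming the marginal away from 0, where it
    is not known in advance to be finite.\<close>
  define q where "q t x v = (\<Psi> x (t *\<^sub>R \<pi> v) - m) / t" for t x v
  define p where "p v = (INF (t, x)\<in>{0<..} \<times> X. q t x v)" for v
  have mix: "\<exists>z\<in>X. (\<Psi> z (a *\<^sub>R v + b *\<^sub>R w) - m) \<le> a * (\<Psi> x v - m) + b * (\<Psi> y w - m)"
    if "x \<in> X" "y \<in> X" "v \<in> S" "w \<in> S" "0 < a" "0 < b" "a + b = 1" for x y v w a b
  proof -
    have "a * m + b * m = m" using that(7) by (simp flip: distrib_right)
    then show ?thesis
      using conv[OF that] by (elim bexE, intro bexI) (auto simp: right_diff_distrib)
  qed
  have St: "t *\<^sub>R \<pi> v \<in> S" for t v using \<pi>(2) S subspace_scale by blast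
  have qsum: "\<exists>r>0. \<exists>z\<in>X. q r z (v + w) \<le> q t x v + q s y w"
    if "0 < t" "0 < s" "x \<in> X" "y \<in> X" for t s x y v w
  proof -
    \<comment> \<open>These weights give \<open>a * t = b * s = r\<close>, so mixing
      \<open>t *\<^sub>R \<pi> v\<close> and \<open>s *\<^sub>R \<pi> w\<close> lands on a multiple
      of \<open>\<pi> (v + w)\<close>.\<close>
    define a where "a = s / (t + s)"
    define b where "b = t / (t + s)"
    define r where "r = t * s / (t + s)"
    have ab: "0 < a" "0 < b" "a + b = 1" and r: "0 < r" "a * t = r" "b * s = r"
      using that by (simp_all add: a_def b_def r_def add.commute flip: add_divide_distrib)
    obtain z where z: "z \<in> X"
      "\<Psi> z (a *\<^sub>R (t *\<^sub>R \<pi> v) + b *\<^sub>R (s *\<^sub>R \<pi> w)) - m \<le> a * (\<Psi> x (t *\<^sub>R \<pi> v) - m) + b * (\<Psi> y (s *\<^sub>R \<pi> w) - m)"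
      using mix[OF \<open>x \<in> X\<close> \<open>y \<in> X\<close> St St ab] by blast
    have "\<Psi> z (r *\<^sub>R \<pi> (v + w)) - m \<le> a * (\<Psi> x (t *\<^sub>R \<pi> v) - m) + b * (\<Psi> y (s *\<^sub>R \<pi> w) - m)"
      using z(2) r by (simp add: \<pi>_add scaleR_add_right)
    also have "\<dots> = r * (q t x v + q s y w)"
    proof -
      have "a * (\<Psi> x (t *\<^sub>R \<pi> v) - m) = a * t * q t x v" "b * (\<Psi> y (s *\<^sub>R \<pi> w) - m) = b * s * q s y w"
        using that by (simp_all add: q_def)
      then show ?thesis using r by (simp add: distrib_left)
    qed
    finally have "q r z (v + w) \<le> q t x v + q s y w"
      using r(1) by (simp add: q_def pos_divide_le_eq mult.commute)
    with r(1) z(1) show ?thesis by blast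
  qed
  have q0: "0 \<le> q t x 0" if "0 < t" "x \<in> X" for t x
    using min[OF that(2)] that(1) linear_0[OF \<pi>(1)] by (simp add: q_def m_def)
  \<comment> \<open>\<open>qsum\<close> for \<open>v\<close> and \<open>- v\<close>, with
    \<open>q0\<close> at their sum, bounds every quotient below independently of \<open>t\<close>
    and \<open>x\<close>; hence the infimum is finite.\<close>
  have lb: "- q 1 xb (- v) \<le> q t x v" if "0 < t" "x \<in> X" for t x v
    using qsum[OF that(1) zero_less_one that(2) xb, of v "- v"] q0 by fastforce
  have bdd: "bdd_below ((\<lambda>(t, x). q t x v) ` ({0<..} \<times> X))" for v
    using lb by (intro bdd_belowI2[where m = "- q 1 xb (- v)"]) auto
  have le: "p v \<le> q t x v" if "0 < t" "x \<in> X" for t x v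
    unfolding p_def using that by (intro cINF_lower2[OF bdd, of "(t, x)"]) auto
  have ne: "{0<..} \<times> X \<noteq> ({} :: (real \<times> 'x) set)"
    using xb gt_ex[of "0::real"] by (auto simp: Sigma_empty_iff)
  have ge: "c \<le> p v" if "\<And>t x. 0 < t \<Longrightarrow> x \<in> X \<Longrightarrow> c \<le> q t x v" for c v
    unfolding p_def using that by (intro cINF_greatest ne) auto
  have "sublinear p"
  proof (rule sublinearI)
    fix v w
    have 1: "p (v + w) \<le> q t x v + q s y w" if "0 < t" "0 < s" "x \<in> X" "y \<in> X" for t s x y
      using qsum[OF that, of v w] le order_trans by blast
    have "p (v + w) - q t x v \<le> p w" if "0 < t" "x \<in> X" for t x
      using 1[OF that(1) _ that(2)] by (intro ge) (simp add: diff_le_eq add.commute)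
    then have "p (v + w) - p w \<le> q t x v" if "0 < t" "x \<in> X" for t x
      using that by (simp add: diff_le_eq add.commute)
    from ge[OF this] show "p (v + w) \<le> p v + p w" by simp
  next
    have "q 1 xb 0 = 0" using linear_0[OF \<pi>(1)] by (simp add: q_def m_def)
    then show "p 0 = 0" using le[of 1 xb 0] ge[of 0 0] q0 xb by (intro antisym) auto
  next
    fix c :: real and v assume c: "0 < c"
    have "p (c *\<^sub>R v) / c \<le> p v"
    proof (rule ge)
      fix t :: real and x assume tx: "0 < t" "x \<in> X"
      have "p (c *\<^sub>R v) \<le> q (t / c) x (c *\<^sub>R v)" using tx c by (intro le) auto
      also have "\<dots> = c * q t x v" using c by (simp add: q_def \<pi>_scale)
      finally show "p (c *\<^sub>R v) / c \<le> q t x v" using c by (simp add: field_simps)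
    qed
    then show "p (c *\<^sub>R v) \<le> c * p v" using c by (simp add: field_simps)
  qed
  then obtain G where G: "linear G" "\<And>v. G v \<le> p v"
    using hahn_banach_sublinear by blast
  \<comment> \<open>At step 1 the quotient is \<open>\<Psi> x v - m\<close>, because
    \<open>\<pi>\<close> fixes \<open>v\<close>.\<close>
  have "\<Psi> xb 0 + G v \<le> \<Psi> x v" if "x \<in> X" "v \<in> S" for x v
    using G(2)[of v] le[OF zero_less_one that(1), of v] \<pi>(3)[OF that(2)] by (simp add: q_def m_def)
  with G(1) that show thesis by blast
qed

section \<open>Closed cones and Caratheodory maps\<close>

lemma AE_nonneg_integralI:
  fixes f :: "'a \<Rightarrow> real"
  assumes f: "integrable M f" and A: "\<And>A. A \<in> sets M \<Longrightarrow> 0 \<le> (LINT x|M. indicator A x * f x)"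
  shows "AE x in M. 0 \<le> f x"
proof -
  have [measurable]: "f \<in> borel_measurable M" using f by auto
  \<comment> \<open>On the negative set the nonnegative function \<open>?g\<close> must have
    integral 0.\<close>
  define A where "A = {x \<in> space M. f x < 0}"
  have [measurable]: "A \<in> sets M" unfolding A_def by measurable
  let ?g = "\<lambda>x. indicator A x * - f x"
  have int: "integrable M (\<lambda>x. indicator A x * f x)"
    using integrable_mult_indicator[OF _ f, of A] by simp
  have nn: "0 \<le> ?g x" for x by (auto simp: A_def indicator_def)
  have "(LINT x|M. ?g x) = 0"
    using A[of A] Bochner_Integration.integral_nonneg[of M ?g] nn int by (auto intro!: antisym)
  then have "AE x in M. ?g x = 0"
    using integral_nonneg_eq_0_iff_AE[of M ?g] nn int by auto
  then show ?thesis
    by (rule AE_mp) (auto intro!: AE_I2 simp: A_def indicator_def split: if_splits)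
qed

text \<open>This is the dominating functional for the separation argument of the bipolar theorem.
  Nearest points of \<open>K\<close> need not exist, so the estimates use almost nearest points,
  which can be added and rescaled within \<open>K\<close>.\<close>

lemma sublinear_infdist_cone:
  fixes K :: "'a::real_normed_vector set"
  assumes "convex K" "cone K" "K \<noteq> {}"
  shows "sublinear (\<lambda>x. infdist x K)"
proof -
  have add: "x + y \<in> K" if "x \<in> K" "y \<in> K" for x y
    using assms that convex_cone[of K] by blast
  have scale: "c *\<^sub>R x \<in> K" if "x \<in> K" "0 \<le> c" for x c
    using assms that by (simp add: cone_def)
  have near: "\<exists>s\<in>K. dist x s < infdist x K + e" if "0 < e" for x e
  proof (rule ccontr)
    assume "\<not> ?thesis"
    then have "infdist x K + e \<le> infdist x K"
      using assms(3) by (subst (2) infdist_notempty) (auto intro!: cINF_greatest simp: not_less)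
    with that show False by simp
  qed
  show ?thesis
  proof (rule sublinearI)
    fix x y
    show "infdist (x + y) K \<le> infdist x K + infdist y K"
    proof (rule field_le_epsilon)
      fix e :: real assume e: "0 < e"
      obtain s t where s: "s \<in> K" "dist x s < infdist x K + e / 2"
        and t: "t \<in> K" "dist y t < infdist y K + e / 2"
        using near[of "e / 2" x] near[of "e / 2" y] e by auto
      have "infdist (x + y) K \<le> dist (x + y) (s + t)" by (intro infdist_le add s t)
      also have "\<dots> \<le> dist x s + dist y t" by (rule dist_triangle_add)
      finally show "infdist (x + y) K \<le> infdist x K + infdist y K + e" using s t by simp
    qed
  next
    obtain k where "k \<in> K" using assms(3) by auto
    then show "infdist 0 K = 0" using scale[of k 0] by simp
  next
    fix c :: real and x :: 'a assume c: "0 < c"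
    show "infdist (c *\<^sub>R x) K \<le> c * infdist x K"
    proof (rule field_le_epsilon)
      fix e :: real assume e: "0 < e"
      obtain s where s: "s \<in> K" "dist x s < infdist x K + e / c" using near[of "e / c" x] e c by auto
      have "infdist (c *\<^sub>R x) K \<le> dist (c *\<^sub>R x) (c *\<^sub>R s)" using s c by (intro infdist_le scale) auto
      also have "\<dots> = c * dist x s" using c by (simp add: dist_norm flip: scaleR_diff_right)
      also have "\<dots> \<le> c * (infdist x K + e / c)" using s c by (intro mult_left_mono) auto
      finally show "infdist (c *\<^sub>R x) K \<le> c * infdist x K + e" using c by (simp add: algebra_simps)
    qed
  qed
qed

text \<open>Hahn-Banach supplies \<open>F\<close> below the distance to \<open>K\<close>, with
  equality at \<open>r\<close>. It is nonpositive on \<open>K\<close>, so \<open>- F\<close> lies in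
  the dual cone, and the hypothesis at \<open>- F\<close> says that the distance from
  \<open>r\<close> to \<open>K\<close> is at most 0.\<close>

lemma bipolar_closed_cone:
  fixes K :: "'a::real_normed_vector set"
  assumes K: "closed K" "convex K" "cone K" "K \<noteq> {}"
    and r: "\<And>t. t \<in> dual_cone K \<Longrightarrow> 0 \<le> blinfun_apply t r"
  shows "r \<in> K"
proof (rule ccontr)
  assume nr: "r \<notin> K"
  obtain F where F: "linear F" "\<And>x. F x \<le> infdist x K" "F r = infdist r K"
    using hahn_banach_sublinear[OF sublinear_infdist_cone[OF K(2-4)]] by blast
  have "0 \<in> K" using K(3,4) by (metis cone_contains_0)
  then have le: "F x \<le> norm x" for x using F(2)[of x] infdist_le[of 0 K x] by simp
  have bl: "bounded_linear F"
  proof (rule bounded_linear_intro[where K = 1])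
    fix x
    show "norm (F x) \<le> norm x * 1"
      using le[of x] le[of "- x"] linear_neg[OF F(1), of x] by (simp add: abs_le_iff)
  qed (simp_all add: linear_add[OF F(1)] linear_scale[OF F(1)])
  have "- Blinfun F \<in> dual_cone K"
    unfolding dual_cone_def
  proof safe
    fix x assume "x \<in> K"
    then show "0 \<le> blinfun_apply (- Blinfun F) x"
      using F(2)[of x] by (simp add: blinfun.minus_left bounded_linear_Blinfun_apply[OF bl])
  qed
  from r[OF this] have "infdist r K \<le> 0"
    by (simp add: blinfun.minus_left bounded_linear_Blinfun_apply[OF bl] F(3))
  then show False
    using nr in_closed_iff_infdist_zero[OF K(1,4), of r] infdist_nonneg[of r K] by auto
qed

text \<open>Each \<open>t\<close> comes with its own null set; a countable dense subset of the dual
  cone, available because the dual is separable, merges them into one. For fixed \<omega> the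
  condition is closed in \<open>t\<close>, so it extends to the whole dual cone.\<close>

lemma AE_mem_closed_coneI:
  fixes K :: "'a::{reflexive_banach, second_countable_topology} set"
  assumes K: "closed K" "convex K" "cone K" "K \<noteq> {}"
    and h: "integrable M h"
    and nonneg: "\<And>t A. t \<in> dual_cone K \<Longrightarrow> A \<in> sets M \<Longrightarrow>
      0 \<le> (LINT \<omega>|M. indicator A \<omega> * blinfun_apply t (h \<omega>))"
  shows "AE \<omega> in M. h \<omega> \<in> K"
proof -
  obtain D :: "('a \<Rightarrow>\<^sub>L real) set" where D: "countable D" "D \<subseteq> dual_cone K" "dual_cone K \<subseteq> closure D"
    using separable[of "dual_cone K"] by metis
  have "AE \<omega> in M. 0 \<le> blinfun_apply t (h \<omega>)" if "t \<in> D" for t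
    using that D nonneg[of t] h
    by (intro AE_nonneg_integralI integrable_bounded_linear[OF blinfun.bounded_linear_right]) auto
  then have "AE \<omega> in M. \<forall>t\<in>D. 0 \<le> blinfun_apply t (h \<omega>)"
    using D(1) by (simp add: AE_ball_countable)
  then show ?thesis
  proof (rule AE_mp, intro AE_I2 impI)
    fix \<omega> assume 0: "\<forall>t\<in>D. 0 \<le> blinfun_apply t (h \<omega>)"
    have "closed {t :: 'a \<Rightarrow>\<^sub>L real. 0 \<le> blinfun_apply t (h \<omega>)}"
      by (intro closed_Collect_le continuous_on_const linear_continuous_on blinfun.bounded_linear_left)
    moreover have "D \<subseteq> {t. 0 \<le> blinfun_apply t (h \<omega>)}" using 0 by blast
    ultimately have "closure D \<subseteq> {t. 0 \<le> blinfun_apply t (h \<omega>)}"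
      by (rule closure_minimal[rotated])
    with D(3) show "h \<omega> \<in> K" by (intro bipolar_closed_cone[OF K]) auto
  qed
qed

section \<open>Maps continuous in the decision and measurable in the random parameter\<close>

text \<open>With a simple function in place of \<open>y\<close>, the composition agrees on each
  level set with one measurable map \<open>f z\<close>; continuity in \<open>z\<close> passes to the
  limit.\<close>

lemma borel_measurable_Caratheodory:
  fixes f :: "'z::{metric_space, second_countable_topology} \<Rightarrow> 'm \<Rightarrow> 'b::metric_space"
  assumes cont: "\<And>\<omega>. \<omega> \<in> space M \<Longrightarrow> continuous_on UNIV (\<lambda>z. f z \<omega>)"
    and meas: "\<And>z. f z \<in> borel_measurable M"
    and y: "y \<in> borel_measurable M"
  shows "(\<lambda>\<omega>. f (y \<omega>) \<omega>) \<in> borel_measurable M"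
proof -
  obtain s where s: "\<And>n. simple_function M (s n)" "\<And>\<omega>. \<omega> \<in> space M \<Longrightarrow> (\<lambda>n. s n \<omega>) \<longlonglongrightarrow> y \<omega>"
    using borel_measurable_implies_sequence_metric[OF y, of undefined] by blast
  show ?thesis
  proof (rule borel_measurable_LIMSEQ_metric)
    fix n
    show "(\<lambda>\<omega>. f (s n \<omega>) \<omega>) \<in> borel_measurable M"
    proof (rule measurable_compose_countable'[where I = "s n ` space M"])
      show "s n \<in> M \<rightarrow>\<^sub>M count_space (s n ` space M)"
        using s(1)[of n] by (simp add: simple_function_def measurable_count_space_eq2)
      show "countable (s n ` space M)"
        using s(1)[of n] by (simp add: simple_function_def countable_finite)
    qed (rule meas)
  next
    fix \<omega> assume \<omega>: "\<omega> \<in> space M"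
    show "(\<lambda>n. f (s n \<omega>) \<omega>) \<longlonglongrightarrow> f (y \<omega>) \<omega>"
      using continuous_on_tendsto_compose[OF cont[OF \<omega>] s(2)[OF \<omega>]] by simp
  qed
qed

text \<open>The null set may depend on \<open>z\<close> in the hypothesis but not in the conclusion.
  A countable dense subset of \<open>S\<close> and continuity in \<open>z\<close> allow the
  exchange.\<close>

lemma AE_norm_le_uniform:
  fixes f :: "'z::{real_normed_vector, second_countable_topology} \<Rightarrow> 'm \<Rightarrow> 'b::real_normed_vector"
  assumes cont: "\<And>\<omega>. \<omega> \<in> space M \<Longrightarrow> continuous_on UNIV (\<lambda>z. f z \<omega>)"
    and le: "\<And>z. z \<in> S \<Longrightarrow> AE \<omega> in M. norm (f z \<omega>) \<le> b"
  shows "AE \<omega> in M. \<forall>z\<in>S. norm (f z \<omega>) \<le> b"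
proof -
  obtain D where D: "countable D" "D \<subseteq> S" "S \<subseteq> closure D"
    using separable[of S] by metis
  have "AE \<omega> in M. \<forall>z\<in>D. norm (f z \<omega>) \<le> b"
    using D le by (subst AE_ball_countable) auto
  then show ?thesis
  proof (rule AE_mp, intro AE_I2 impI)
    fix \<omega> assume \<omega>: "\<omega> \<in> space M" and 0: "\<forall>z\<in>D. norm (f z \<omega>) \<le> b"
    have "closed {z. norm (f z \<omega>) \<le> b}"
      by (intro closed_Collect_le continuous_on_norm cont \<omega> continuous_on_const)
    moreover have "D \<subseteq> {z. norm (f z \<omega>) \<le> b}" using 0 by blast
    ultimately have "closure D \<subseteq> {z. norm (f z \<omega>) \<le> b}"
      by (rule closure_minimal[rotated])
    with D(3) show "\<forall>z\<in>S. norm (f z \<omega>) \<le> b" by auto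
  qed
qed

section \<open>A Radon--Nikodym theorem with values in the dual\<close>

lemma integrable_indicator_mult:
  fixes f :: "'a \<Rightarrow> real"
  assumes "integrable M f" "A \<in> sets M"
  shows "integrable M (\<lambda>x. indicator A x * f x)"
  using integrable_mult_indicator[OF assms(2,1)] by simp

lemma AE_eq_integralI:
  fixes f :: "'a \<Rightarrow> real"
  assumes f: "integrable M f" and g: "integrable M g"
    and eq: "\<And>A. A \<in> sets M \<Longrightarrow> (LINT x|M. indicator A x * f x) = (LINT x|M. indicator A x * g x)"
  shows "AE x in M. f x = g x"
proof -
  have "AE x in M. 0 \<le> f x - g x"
    by (rule AE_nonneg_integralI) (simp_all add: assms right_diff_distrib integrable_indicator_mult)
  moreover have "AE x in M. 0 \<le> g x - f x"
    by (rule AE_nonneg_integralI) (simp_all add: assms right_diff_distrib integrable_indicator_mult)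
  ultimately show ?thesis by eventually_elim simp
qed

text \<open>Adding the measure \<open>C\<close> with density \<open>c\<close> makes
  \<open>\<mu>\<close> nonnegative. The sum turns out to be a finite measure, absolutely continuous
  with respect to \<open>M\<close>, and \<open>g\<close> is its density minus
  \<open>c\<close>.\<close>

lemma (in finite_measure) signed_Radon_Nikodym:
  fixes \<mu> :: "'a set \<Rightarrow> real"
  assumes c: "integrable M c"
    and add: "\<And>A B. \<lbrakk>A \<in> sets M; B \<in> sets M; A \<inter> B = {}\<rbrakk> \<Longrightarrow> \<mu> (A \<union> B) = \<mu> A + \<mu> B"
    and le: "\<And>A. A \<in> sets M \<Longrightarrow> \<bar>\<mu> A\<bar> \<le> (LINT x|M. indicator A x * c x)"
  obtains g where "integrable M g" "AE x in M. \<bar>g x\<bar> \<le> c x"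
    "\<And>A. A \<in> sets M \<Longrightarrow> \<mu> A = (LINT x|M. indicator A x * g x)"
proof -
  have [measurable]: "c \<in> borel_measurable M" using c by auto
  define C where "C A = (LINT x|M. indicator A x * c x)" for A
  have C_add: "C (A \<union> B) = C A + C B" if "A \<in> sets M" "B \<in> sets M" "A \<inter> B = {}" for A B
  proof -
    have "C (A \<union> B) = (LINT x|M. indicator A x * c x + indicator B x * c x)"
      unfolding C_def using that(3)
      by (intro Bochner_Integration.integral_cong) (auto simp: indicator_def)
    then show ?thesis using that c by (simp add: C_def integrable_indicator_mult)
  qed
  have le': "\<bar>\<mu> A\<bar> \<le> C A" if "A \<in> sets M" for A using le[OF that] by (simp add: C_def)
  define \<nu> where "\<nu> A = ennreal (\<mu> A + C A)" for A
  have nn: "0 \<le> \<mu> A + C A" if "A \<in> sets M" for A using le'[OF that] by linarith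
  have pos: "positive (sets M) \<nu>"
    using le'[of "{}"] by (simp add: positive_def \<nu>_def C_def)
  have ca: "countably_additive (sets M) \<nu>"
  \<comment> \<open>Finite additivity becomes countable additivity through continuity at the empty
    set, which holds since \<nu> is at most \<open>2 * C\<close> and \<open>C\<close> tends to 0 by
    dominated convergence.\<close>
  proof (rule sets.empty_continuous_imp_countably_additive[OF pos])
    show "additive (sets M) \<nu>"
      unfolding additive_def
    proof (intro ballI impI)
      fix A B assume "A \<in> sets M" "B \<in> sets M" "A \<inter> B = {}"
      then show "\<nu> (A \<union> B) = \<nu> A + \<nu> B"
        using nn[of A] nn[of B] by (simp add: \<nu>_def add C_add flip: ennreal_plus)
    qed
    show "\<forall>A\<in>sets M. \<nu> A \<noteq> \<infinity>" by (simp add: \<nu>_def)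
    fix A :: "nat \<Rightarrow> 'a set" assume A: "range A \<subseteq> sets M" "decseq A" "(\<Inter>i. A i) = {}"
    have [measurable]: "A i \<in> sets M" for i using A(1) by auto
    have "(\<lambda>i. C (A i)) \<longlonglongrightarrow> (LINT x|M. 0)"
      unfolding C_def
    proof (rule integral_dominated_convergence[where w = "\<lambda>x. norm (c x)"])
      show "AE x in M. (\<lambda>i. indicator (A i) x * c x) \<longlonglongrightarrow> 0"
      proof (rule AE_I2)
        fix x
        have "(\<lambda>i. indicator (A i) x :: real) \<longlonglongrightarrow> indicator (\<Inter>i. A i) x"
          using A(2) by (rule LIMSEQ_indicator_decseq)
        then show "(\<lambda>i. indicator (A i) x * c x) \<longlonglongrightarrow> 0"
          unfolding A(3) by (simp add: tendsto_mult_left_zero)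
      qed
    qed (use c in \<open>auto simp: indicator_def\<close>)
    then have "(\<lambda>i. ennreal (2 * C (A i))) \<longlonglongrightarrow> ennreal (2 * 0)"
      by (intro tendsto_ennrealI tendsto_mult_left) simp
    then have lim: "(\<lambda>i. ennreal (2 * C (A i))) \<longlonglongrightarrow> 0" by simp
    show "(\<lambda>i. \<nu> (A i)) \<longlonglongrightarrow> 0"
    proof (rule tendsto_sandwich[OF _ _ tendsto_const lim])
      have "\<mu> (A i) + C (A i) \<le> 2 * C (A i)" for i using le'[of "A i"] by simp
      then show "eventually (\<lambda>i. \<nu> (A i) \<le> ennreal (2 * C (A i))) sequentially"
        by (auto simp: \<nu>_def intro!: always_eventually ennreal_leI)
    qed simp_all
  qed
  define N where "N = measure_of (space M) (sets M) \<nu>"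
  have sets_N: "sets N = sets M" and space_N: "space N = space M" by (auto simp: N_def)
  have emN: "emeasure N A = \<nu> A" if "A \<in> sets M" for A
    using that pos ca unfolding N_def
    by (intro emeasure_measure_of_sigma sets.sigma_algebra_axioms)
  have "finite_measure N"
    by (rule finite_measureI) (simp add: space_N emN \<nu>_def)
  moreover have "absolutely_continuous M N"
    unfolding absolutely_continuous_def
  proof
    fix A assume A: "A \<in> null_sets M"
    then have "AE x in M. indicator A x * c x = 0"
      by (auto dest: AE_not_in simp: indicator_def)
    then have "C A = 0" unfolding C_def by (rule integral_eq_zero_AE)
    then show "A \<in> null_sets N"
      using A le'[of A] by (auto simp: null_sets_def emN sets_N \<nu>_def)
  qed
  ultimately obtain f where f[measurable]: "f \<in> borel_measurable M" and N: "density M f = N"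
    using Radon_Nikodym_finite_measure[of N] sets_N by blast
  have nnf: "(\<integral>\<^sup>+x. f x * indicator A x \<partial>M) = ennreal (\<mu> A + C A)" if "A \<in> sets M" for A
    using that emN[OF that] by (simp flip: N add: emeasure_density \<nu>_def)
  have "(\<integral>\<^sup>+x. f x \<partial>M) \<noteq> \<infinity>"
    using nnf[OF sets.top] by (simp cong: nn_integral_cong)
  then have fin: "AE x in M. f x \<noteq> \<infinity>" using f by (intro nn_integral_PInf_AE) auto
  have nn_eq: "(\<integral>\<^sup>+x. ennreal (indicator A x * enn2real (f x)) \<partial>M) = ennreal (\<mu> A + C A)"
    if A: "A \<in> sets M" for A
  proof -
    have "(\<integral>\<^sup>+x. ennreal (indicator A x * enn2real (f x)) \<partial>M) = (\<integral>\<^sup>+x. f x * indicator A x \<partial>M)"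
      using fin by (intro nn_integral_cong_AE) (auto simp: indicator_def less_top)
    then show ?thesis by (simp add: nnf[OF A])
  qed
  have int_eq: "(LINT x|M. indicator A x * enn2real (f x)) = \<mu> A + C A" if A[measurable]: "A \<in> sets M" for A
    using nn_eq[OF A] nn[OF A] by (subst integral_eq_nn_integral) auto
  have intf: "integrable M (\<lambda>x. enn2real (f x))"
    using nn_eq[OF sets.top] by (intro integrableI_nonneg) (auto simp: less_top cong: nn_integral_cong)
  define g where "g = (\<lambda>x. enn2real (f x) - c x)"
  have g: "integrable M g" unfolding g_def using intf c by simp
  have \<mu>: "\<mu> A = (LINT x|M. indicator A x * g x)" if "A \<in> sets M" for A
    using int_eq[OF that] intf c that
    by (simp add: g_def right_diff_distrib integrable_indicator_mult C_def)
  \<comment> \<open>The bound on \<open>g\<close> is recovered by testing \<open>c - g\<close> and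
    \<open>c + g\<close> on arbitrary sets.\<close>
  have "AE x in M. 0 \<le> c x - g x"
    using c g le by (intro AE_nonneg_integralI)
      (auto simp: right_diff_distrib integrable_indicator_mult \<mu>[symmetric] abs_le_iff)
  moreover have "AE x in M. 0 \<le> c x + g x"
  proof (rule AE_nonneg_integralI)
    fix A assume A: "A \<in> sets M"
    then show "0 \<le> (LINT x|M. indicator A x * (c x + g x))"
      using c g nn[OF A] by (simp add: distrib_left integrable_indicator_mult \<mu>[symmetric] C_def)
  qed (use c g in simp)
  ultimately have "AE x in M. \<bar>g x\<bar> \<le> c x" by eventually_elim simp
  with g \<mu> that show thesis by blast
qed

text \<open>
  McShane's formula gives a measurable extension without any choice. Measuring the failure of linearity
  on \<open>B\<close> as below avoids asking \<open>B\<close> to be closed under linear combinations.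
\<close>

lemma Lipschitz_linear_extension:
  fixes g :: "'x::real_normed_vector \<Rightarrow> real"
  assumes B: "closure B = UNIV" and c: "0 \<le> c"
    and le: "\<And>a b d p q. \<lbrakk>a \<in> B; b \<in> B; d \<in> B; p \<in> \<rat>; q \<in> \<rat>\<rbrakk> \<Longrightarrow>
      \<bar>g d - p * g a - q * g b\<bar> \<le> c * norm (d - p *\<^sub>R a - q *\<^sub>R b)"
  defines "\<gamma> \<equiv> \<lambda>y. INF b\<in>B. g b + c * norm (y - b)"
  shows "bdd_below ((\<lambda>b. g b + c * norm (y - b)) ` B)"
    and "bounded_linear \<gamma>" and "\<bar>\<gamma> y\<bar> \<le> c * norm y" and "b \<in> B \<Longrightarrow> \<gamma> b = g b"
proof -
  have ne: "B \<noteq> {}" using B by auto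
  \<comment> \<open>The case p = 1, q = 0 of \<open>le\<close> is Lipschitz continuity on
    \<open>B\<close>; it makes the infimum finite and equal to \<open>g\<close> on
    \<open>B\<close>.\<close>
  have lip: "g a \<le> g b + c * norm (a - b)" if "a \<in> B" "b \<in> B" for a b
    using le[of b b a 1 0] that by simp
  have tri: "c * norm (y - a) \<le> c * norm (y - b) + c * norm (a - b)" for y a b :: 'x
    using mult_left_mono[OF norm_triangle_ineq[of "y - b" "b - a"] c]
    by (simp add: distrib_left norm_minus_commute)
  obtain a0 where a0: "a0 \<in> B" using ne by auto
  show bdd: "bdd_below ((\<lambda>b. g b + c * norm (y - b)) ` B)" for y
  proof (rule bdd_belowI2[where m = "g a0 - c * norm (y - a0)"])
    fix b assume "b \<in> B"
    then show "g a0 - c * norm (y - a0) \<le> g b + c * norm (y - b)"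
      using lip[OF a0, of b] tri[of a0 b y] by (simp add: norm_minus_commute)
  qed
  have lower: "\<gamma> y \<le> g b + c * norm (y - b)" if "b \<in> B" for b y
    unfolding \<gamma>_def using that by (intro cINF_lower bdd)
  have greatest: "m \<le> \<gamma> y" if "\<And>b. b \<in> B \<Longrightarrow> m \<le> g b + c * norm (y - b)" for m y
    unfolding \<gamma>_def using that by (intro cINF_greatest ne)
  show \<gamma>_eq: "\<gamma> b = g b" if "b \<in> B" for b
    using lower[OF that, of b] lip[OF that] by (intro antisym greatest) auto
  have \<gamma>_lip: "\<gamma> y \<le> \<gamma> z + c * norm (y - z)" for y z
  proof -
    have "\<gamma> y - c * norm (y - z) \<le> \<gamma> z"
    proof (rule greatest)
      fix b assume "b \<in> B"
      then show "\<gamma> y - c * norm (y - z) \<le> g b + c * norm (z - b)"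
        using lower[of b y] tri[of y b z] by (simp add: norm_minus_commute)
    qed
    then show ?thesis by simp
  qed
  have cont: "continuous_on UNIV \<gamma>"
  proof (rule lipschitz_on_continuous_on)
    show "c-lipschitz_on UNIV \<gamma>"
    proof (rule lipschitz_onI)
      fix y z
      show "dist (\<gamma> y) (\<gamma> z) \<le> c * dist y z"
        using \<gamma>_lip[of y z] \<gamma>_lip[of z y] by (simp add: dist_norm abs_le_iff norm_minus_commute)
    qed (rule c)
  qed
  \<comment> \<open>The defect inequality is a closed condition in all five variables, coefficients
    included, so it spreads from \<open>B\<close> and the rationals to all points and all real
    coefficients.\<close>
  define T where "T = {(d, a, b, p, q). \<bar>\<gamma> d - p * \<gamma> a - q * \<gamma> b\<bar> \<le> c * norm (d - p *\<^sub>R a - q *\<^sub>R b)}"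
  have "B \<times> B \<times> B \<times> \<rat> \<times> \<rat> \<subseteq> T" using le \<gamma>_eq by (auto simp: T_def)
  moreover have "closed T"
    unfolding T_def case_prod_beta
    by (intro closed_Collect_le continuous_intros continuous_on_compose2[OF cont]) auto
  ultimately have "closure (B \<times> B \<times> B \<times> \<rat> \<times> \<rat>) \<subseteq> T" by (rule closure_minimal)
  then have "T = UNIV" by (auto simp: closure_Times B Rats_closure_real)
  then have all: "\<bar>\<gamma> d - p * \<gamma> a - q * \<gamma> b\<bar> \<le> c * norm (d - p *\<^sub>R a - q *\<^sub>R b)" for d a b p q
    by (auto simp: T_def set_eq_iff)
  show bound: "\<bar>\<gamma> y\<bar> \<le> c * norm y" for y using all[of y 0 0 0 0] by simp
  \<comment> \<open>When \<open>d\<close> is the linear combination itself, the right-hand side of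
    \<open>all\<close> vanishes and exact additivity or homogeneity remains.\<close>
  show "bounded_linear \<gamma>"
  proof (rule bounded_linear_intro)
    show "\<gamma> (x + y) = \<gamma> x + \<gamma> y" for x y using all[of "x + y" 1 x 1 y] by simp
    show "\<gamma> (r *\<^sub>R x) = r *\<^sub>R \<gamma> x" for r x using all[of "r *\<^sub>R x" r x 0 x] by simp
    show "norm (\<gamma> x) \<le> norm x * c" for x using bound[of x] by (simp add: mult.commute)
  qed
qed

text \<open>A Pettis-type argument. Membership in a closed ball of the dual is a countable family of
  scalar conditions over a dense set of arguments, and every open set is a countable union of closed
  balls with centers in a dense set and rational radii.\<close>

lemma borel_measurable_blinfunI:
  fixes \<rho> :: "'m \<Rightarrow> 'x::{reflexive_banach, second_countable_topology} \<Rightarrow>\<^sub>L real"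
  assumes meas[measurable]: "\<And>x. (\<lambda>\<omega>. \<rho> \<omega> x) \<in> borel_measurable M"
  shows "\<rho> \<in> borel_measurable M"
proof -
  obtain B :: "'x set" where B: "countable B" "closure B = UNIV"
    by (metis separable top.extremum_uniqueI)
  obtain D :: "('x \<Rightarrow>\<^sub>L real) set" where D: "countable D" "closure D = UNIV"
    by (metis separable top.extremum_uniqueI)
  have cball: "\<rho> -` cball \<phi> r \<inter> space M \<in> sets M" if r: "0 \<le> r" for \<phi> r
  proof -
    have "f \<in> cball \<phi> r \<longleftrightarrow> (\<forall>x\<in>B. \<bar>f x - \<phi> x\<bar> \<le> r * norm x)" for f
    proof
      assume "f \<in> cball \<phi> r"
      then have "norm (f - \<phi>) \<le> r" by (simp add: dist_norm norm_minus_commute)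
      then have "norm ((f - \<phi>) x) \<le> r * norm x" for x
        using norm_blinfun[of "f - \<phi>" x] mult_right_mono[of "norm (f - \<phi>)" r "norm x"] by simp
      then show "\<forall>x\<in>B. \<bar>f x - \<phi> x\<bar> \<le> r * norm x" by (simp add: blinfun.diff_left)
    next
      assume "\<forall>x\<in>B. \<bar>f x - \<phi> x\<bar> \<le> r * norm x"
      then have "B \<subseteq> {x. norm ((f - \<phi>) x) \<le> r * norm x}" by (auto simp: blinfun.diff_left)
      moreover have "closed {x. norm ((f - \<phi>) x) \<le> r * norm x}"
        by (intro closed_Collect_le continuous_intros)
      ultimately have "closure B \<subseteq> {x. norm ((f - \<phi>) x) \<le> r * norm x}" by (rule closure_minimal)
      then have "norm (f - \<phi>) \<le> r" using B(2) r by (intro norm_blinfun_bound) auto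
      then show "f \<in> cball \<phi> r" by (simp add: dist_norm norm_minus_commute)
    qed
    then have "\<rho> -` cball \<phi> r \<inter> space M = {\<omega> \<in> space M. \<forall>x\<in>B. \<bar>\<rho> \<omega> x - \<phi> x\<bar> \<le> r * norm x}"
      by auto
    also have "\<dots> \<in> sets M"
      using B(1) by (intro sets.sets_Collect_countable_All') measurable
    finally show ?thesis .
  qed
  show ?thesis
  proof (rule borel_measurableI)
    fix U :: "('x \<Rightarrow>\<^sub>L real) set" assume U: "open U"
    define I where "I = {(d, r). d \<in> D \<and> r \<in> \<rat> \<and> 0 \<le> r \<and> cball d r \<subseteq> U}"
    have "I \<subseteq> D \<times> \<rat>" by (auto simp: I_def)
    then have "countable I" using D(1) countable_rat by (meson countable_SIGMA countable_subset)
    have "\<exists>(d, r)\<in>I. u \<in> cball d r" if "u \<in> U" for u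
    proof -
      obtain e where e: "0 < e" "ball u e \<subseteq> U" using openE[OF U \<open>u \<in> U\<close>] by blast
      obtain r where r: "r \<in> \<rat>" "0 < r" "r < e / 2" using Rats_dense_in_real[of 0 "e / 2"] e by auto
      obtain d where d: "d \<in> D" "dist d u < r" by (metis D(2) r(2) closure_approachable UNIV_I)
      have "cball d r \<subseteq> ball u e"
      proof
        fix y assume "y \<in> cball d r"
        then show "y \<in> ball u e"
          using dist_triangle[of u y d] d(2) r(3) by (simp add: dist_commute)
      qed
      with d r e show ?thesis by (intro bexI[of _ "(d, r)"]) (auto simp: I_def)
    qed
    then have "U \<subseteq> (\<Union>(d, r)\<in>I. cball d r)" by blast
    moreover have "(\<Union>(d, r)\<in>I. cball d r) \<subseteq> U" by (auto simp: I_def)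
    ultimately have "U = (\<Union>(d, r)\<in>I. cball d r)" by (rule antisym)
    then have "\<rho> -` U \<inter> space M = (\<Union>(d, r)\<in>I. \<rho> -` cball d r \<inter> space M)" by auto
    also have "\<dots> \<in> sets M"
      using cball \<open>countable I\<close> by (intro sets.countable_UN'') (auto simp: I_def)
    finally show "\<rho> -` U \<inter> space M \<in> sets M" .
  qed
qed

text \<open>Every \<open>x\<close> has a scalar density \<open>g x\<close>, but linearity in
  \<open>x\<close> holds only almost everywhere, with a null set for each relation. Restricting to a
  countable dense \<open>B\<close> and rational coefficients leaves one null set, off which the
  densities extend to a bounded functional of norm at most \<open>c \<omega>\<close>.\<close>

lemma (in finite_measure) dual_Radon_Nikodym:
  fixes \<mu> :: "'a set \<Rightarrow> 'x::{reflexive_banach, second_countable_topology} \<Rightarrow> real"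
  assumes c: "integrable M c" and c_nn: "\<And>\<omega>. 0 \<le> c \<omega>"
    and lin: "\<And>A. A \<in> sets M \<Longrightarrow> linear (\<mu> A)"
    and add: "\<And>A B x. \<lbrakk>A \<in> sets M; B \<in> sets M; A \<inter> B = {}\<rbrakk> \<Longrightarrow> \<mu> (A \<union> B) x = \<mu> A x + \<mu> B x"
    and le: "\<And>A x. A \<in> sets M \<Longrightarrow> \<bar>\<mu> A x\<bar> \<le> norm x * (LINT \<omega>|M. indicator A \<omega> * c \<omega>)"
  obtains \<rho> :: "'a \<Rightarrow> 'x \<Rightarrow>\<^sub>L real" where "integrable M \<rho>"
    "\<And>A x. A \<in> sets M \<Longrightarrow> \<mu> A x = (LINT \<omega>|M. indicator A \<omega> * \<rho> \<omega> x)"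
proof -
  have [measurable]: "c \<in> borel_measurable M" using c by auto
  have "\<exists>g. integrable M g \<and> (AE \<omega> in M. \<bar>g \<omega>\<bar> \<le> norm x * c \<omega>) \<and>
      (\<forall>A\<in>sets M. \<mu> A x = (LINT \<omega>|M. indicator A \<omega> * g \<omega>))" for x
  proof (rule signed_Radon_Nikodym[where c = "\<lambda>\<omega>. norm x * c \<omega>" and \<mu> = "\<lambda>A. \<mu> A x"])
    show "\<bar>\<mu> A x\<bar> \<le> (LINT \<omega>|M. indicator A \<omega> * (norm x * c \<omega>))" if "A \<in> sets M" for A
      using le[OF that, of x] by (simp add: mult.left_commute)
  qed (use c add in auto)
  then obtain g where g: "\<And>x. integrable M (g x)"
    and g_le: "\<And>x. AE \<omega> in M. \<bar>g x \<omega>\<bar> \<le> norm x * c \<omega>"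
    and g_eq: "\<And>x A. A \<in> sets M \<Longrightarrow> \<mu> A x = (LINT \<omega>|M. indicator A \<omega> * g x \<omega>)" by metis
  \<comment> \<open>By uniqueness of densities the left-hand side is the absolute value of the
    density of \<open>d - p *\<^sub>R a - q *\<^sub>R b\<close>.\<close>
  have comb: "AE \<omega> in M. \<bar>g d \<omega> - p * g a \<omega> - q * g b \<omega>\<bar> \<le> c \<omega> * norm (d - p *\<^sub>R a - q *\<^sub>R b)" for d a b p q
  proof -
    have "AE \<omega> in M. g (d - p *\<^sub>R a - q *\<^sub>R b) \<omega> = g d \<omega> - p * g a \<omega> - q * g b \<omega>"
    proof (rule AE_eq_integralI)
      fix A assume A: "A \<in> sets M"
      have "(LINT \<omega>|M. indicator A \<omega> * (g d \<omega> - p * g a \<omega> - q * g b \<omega>)) =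
        (LINT \<omega>|M. indicator A \<omega> * g d \<omega> - p * (indicator A \<omega> * g a \<omega>) - q * (indicator A \<omega> * g b \<omega>))"
        by (simp add: algebra_simps)
      also have "\<dots> = \<mu> A d - p * \<mu> A a - q * \<mu> A b"
        using A g by (simp add: g_eq integrable_indicator_mult)
      also have "\<dots> = \<mu> A (d - p *\<^sub>R a - q *\<^sub>R b)"
        using lin[OF A] by (simp add: linear_diff linear_scale)
      finally show "(LINT \<omega>|M. indicator A \<omega> * g (d - p *\<^sub>R a - q *\<^sub>R b) \<omega>) =
          (LINT \<omega>|M. indicator A \<omega> * (g d \<omega> - p * g a \<omega> - q * g b \<omega>))"
        using A by (simp add: g_eq)
    qed (use g in auto)
    with g_le[of "d - p *\<^sub>R a - q *\<^sub>R b"] show ?thesis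
      by eventually_elim (simp add: mult.commute)
  qed
  obtain B :: "'x set" where B: "countable B" "closure B = UNIV"
    by (metis separable top.extremum_uniqueI)
  have "AE \<omega> in M. \<forall>a\<in>B. \<forall>b\<in>B. \<forall>d\<in>B. \<forall>p\<in>\<rat>. \<forall>q\<in>\<rat>.
      \<bar>g d \<omega> - p * g a \<omega> - q * g b \<omega>\<bar> \<le> c \<omega> * norm (d - p *\<^sub>R a - q *\<^sub>R b)"
    using comb B(1) by (simp add: AE_ball_countable countable_rat)
  then obtain N where N: "N \<in> null_sets M" "\<And>\<omega> a b d p q. \<lbrakk>\<omega> \<in> space M - N; a \<in> B; b \<in> B; d \<in> B; p \<in> \<rat>; q \<in> \<rat>\<rbrakk> \<Longrightarrow>
      \<bar>g d \<omega> - p * g a \<omega> - q * g b \<omega>\<bar> \<le> c \<omega> * norm (d - p *\<^sub>R a - q *\<^sub>R b)"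
    by (auto elim!: AE_E3)
  have [measurable]: "N \<in> sets M" "\<And>x. g x \<in> borel_measurable M" using N(1) g by auto
  \<comment> \<open>Zero on the exceptional set satisfies the defect inequality because
    \<open>c\<close> is nonnegative everywhere; so the extension is linear for every
    \<omega>.\<close>
  define h where "h x \<omega> = (if \<omega> \<in> space M - N then g x \<omega> else 0)" for x \<omega>
  have h_comb: "\<bar>h d \<omega> - p * h a \<omega> - q * h b \<omega>\<bar> \<le> c \<omega> * norm (d - p *\<^sub>R a - q *\<^sub>R b)"
    if "a \<in> B" "b \<in> B" "d \<in> B" "p \<in> \<rat>" "q \<in> \<rat>" for \<omega> a b d p q
    using N(2)[of \<omega>, OF _ that] c_nn by (auto simp: h_def)
  define \<gamma> where "\<gamma> \<omega> y = (INF b\<in>B. h b \<omega> + c \<omega> * norm (y - b))" for \<omega> y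
  have ext: "bdd_below ((\<lambda>b. h b \<omega> + c \<omega> * norm (y - b)) ` B)" "bounded_linear (\<gamma> \<omega>)"
      "\<bar>\<gamma> \<omega> y\<bar> \<le> c \<omega> * norm y" "b \<in> B \<Longrightarrow> \<gamma> \<omega> b = h b \<omega>" for \<omega> y b
    unfolding \<gamma>_def by (rule Lipschitz_linear_extension; use B(2) c_nn h_comb in simp)+
  define \<rho> where "\<rho> \<omega> = Blinfun (\<gamma> \<omega>)" for \<omega>
  have \<rho>: "blinfun_apply (\<rho> \<omega>) = \<gamma> \<omega>" for \<omega>
    unfolding \<rho>_def by (rule bounded_linear_Blinfun_apply) (use ext(2) in simp)
  have \<rho>_meas[measurable]: "\<rho> \<in> borel_measurable M"
  proof (rule borel_measurable_blinfunI)
    fix x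
    have [measurable]: "h b \<in> borel_measurable M" for b unfolding h_def by measurable
    show "(\<lambda>\<omega>. \<rho> \<omega> x) \<in> borel_measurable M"
      unfolding \<rho> \<gamma>_def using B(1) ext(1) by (intro borel_measurable_cINF) auto
  qed
  have norm_\<rho>: "norm (\<rho> \<omega>) \<le> c \<omega>" for \<omega>
    using ext(3) c_nn by (intro norm_blinfun_bound) (auto simp: \<rho>)
  have int\<rho>: "integrable M \<rho>"
    by (rule Bochner_Integration.integrable_bound[OF c]) (auto intro!: AE_I2 order_trans[OF norm_\<rho>])
  have [measurable]: "(\<lambda>\<omega>. \<rho> \<omega> x) \<in> borel_measurable M" for x
    using integrable_bounded_linear[OF blinfun.bounded_linear_left int\<rho>] by auto
  have "\<mu> A x = (LINT \<omega>|M. indicator A \<omega> * \<rho> \<omega> x)" if A: "A \<in> sets M" for A x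
  proof -
    have 1: "AE \<omega> in M. \<forall>b\<in>B. \<bar>g x \<omega> - g b \<omega>\<bar> \<le> c \<omega> * norm (x - b)"
      using comb[of x 1 _ 0 0] B(1) by (simp add: AE_ball_countable)
    \<comment> \<open>\<gamma> was built from densities at points of \<open>B\<close> only. The
      Lipschitz estimate between \<open>x\<close> and \<open>B\<close>, extended to the closure and
      read at y = x, identifies it with \<open>g x\<close>.\<close>
    have "AE \<omega> in M. \<rho> \<omega> x = g x \<omega>"
      using 1 AE_not_in[OF N(1)] AE_space
    proof eventually_elim
      case (elim \<omega>)
      then have "\<rho> \<omega> b = g b \<omega>" if "b \<in> B" for b
        using ext(4)[OF that] by (simp add: \<rho> h_def)
      then have "B \<subseteq> {y. \<bar>g x \<omega> - \<rho> \<omega> y\<bar> \<le> c \<omega> * norm (x - y)}" using elim by auto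
      moreover have "closed {y. \<bar>g x \<omega> - \<rho> \<omega> y\<bar> \<le> c \<omega> * norm (x - y)}"
        by (intro closed_Collect_le continuous_intros)
      ultimately have "closure B \<subseteq> {y. \<bar>g x \<omega> - \<rho> \<omega> y\<bar> \<le> c \<omega> * norm (x - y)}"
        by (rule closure_minimal)
      then have "\<bar>g x \<omega> - \<rho> \<omega> x\<bar> \<le> c \<omega> * norm (x - x)" using B(2) by blast
      then show ?case by simp
    qed
    then show ?thesis
      unfolding g_eq[OF A] using A by (intro integral_cong_AE) auto
  qed
  with int\<rho> that show thesis by blast
qed

section \<open>The multiplier of the nonanticipativity constraint\<close>

text \<open>The envelope on balls makes compositions with bounded functions integrable and later
  controls the subgradient by integrals over sets. Its null set is common to all \<open>z\<close> in
  the ball, so a random argument may be inserted.\<close>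

locale dominated_integrand = finite_measure M for M :: "'m measure" +
  fixes \<phi> :: "'z::{banach, second_countable_topology} \<Rightarrow> 'm \<Rightarrow> real"
  assumes cont: "\<omega> \<in> space M \<Longrightarrow> continuous_on UNIV (\<lambda>z. \<phi> z \<omega>)"
    and meas: "\<phi> z \<in> borel_measurable M"
    and dominated: "\<exists>c. integrable M c \<and> (\<forall>\<omega>. 0 \<le> c \<omega>) \<and> (AE \<omega> in M. \<forall>z. norm z \<le> r \<longrightarrow> \<bar>\<phi> z \<omega>\<bar> \<le> c \<omega>)"
begin

lemma integrable_comp:
  assumes y: "y \<in> L_infinity M"
  shows "integrable M (\<lambda>\<omega>. \<phi> (y \<omega>) \<omega>)"
proof -
  obtain r where r: "AE \<omega> in M. norm (y \<omega>) \<le> r" and [measurable]: "y \<in> borel_measurable M"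
    using y by (auto simp: L_infinity_def)
  obtain c where c: "integrable M c" "AE \<omega> in M. \<forall>z. norm z \<le> r \<longrightarrow> \<bar>\<phi> z \<omega>\<bar> \<le> c \<omega>"
    using dominated[of r] by (elim exE conjE) (rule that)
  show ?thesis
  proof (rule Bochner_Integration.integrable_bound[OF c(1)])
    show "(\<lambda>\<omega>. \<phi> (y \<omega>) \<omega>) \<in> borel_measurable M"
      by (rule borel_measurable_Caratheodory[OF cont meas]) auto
    show "AE \<omega> in M. norm (\<phi> (y \<omega>) \<omega>) \<le> norm (c \<omega>)"
      using r c(2)
    proof eventually_elim
      case (elim \<omega>)
      then have "\<bar>\<phi> (y \<omega>) \<omega>\<bar> \<le> c \<omega>" by blast
      then show ?case by simp
    qed
  qed
qed

end

section \<open>Closure properties of the space of essentially bounded functions\<close>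

lemma L_infinityI:
  "f \<in> borel_measurable M \<Longrightarrow> (AE \<omega> in M. norm (f \<omega>) \<le> c) \<Longrightarrow> f \<in> L_infinity M"
  by (auto simp: L_infinity_def)

lemma L_infinity_const: "(\<lambda>\<omega>. x) \<in> L_infinity M"
  by (intro L_infinityI[where c = "norm x"]) auto

lemma L_infinity_add:
  assumes "f \<in> L_infinity M" "g \<in> L_infinity M"
  shows "(\<lambda>\<omega>. f \<omega> + g \<omega>) \<in> L_infinity M"
proof -
  obtain a b where "AE \<omega> in M. norm (f \<omega>) \<le> a" "AE \<omega> in M. norm (g \<omega>) \<le> b"
    using assms by (auto simp: L_infinity_def)
  then have "AE \<omega> in M. norm (f \<omega> + g \<omega>) \<le> a + b"
    by eventually_elim (rule norm_triangle_mono)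
  with assms show ?thesis by (intro L_infinityI) (auto simp: L_infinity_def)
qed

lemma L_infinity_scaleR:
  assumes "f \<in> L_infinity M"
  shows "(\<lambda>\<omega>. r *\<^sub>R f \<omega>) \<in> L_infinity M"
proof -
  obtain a where "AE \<omega> in M. norm (f \<omega>) \<le> a"
    using assms by (auto simp: L_infinity_def)
  then have "AE \<omega> in M. norm (r *\<^sub>R f \<omega>) \<le> \<bar>r\<bar> * a"
    by eventually_elim (simp add: mult_left_mono)
  with assms show ?thesis by (intro L_infinityI) (auto simp: L_infinity_def)
qed

lemma L_infinity_Pair:
  assumes "f \<in> L_infinity M" "g \<in> L_infinity M"
  shows "(\<lambda>\<omega>. (f \<omega>, g \<omega>)) \<in> L_infinity M"
proof -
  obtain a b where "AE \<omega> in M. norm (f \<omega>) \<le> a" "AE \<omega> in M. norm (g \<omega>) \<le> b"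
    using assms by (auto simp: L_infinity_def)
  then have "AE \<omega> in M. norm (f \<omega>, g \<omega>) \<le> a + b"
    by eventually_elim (rule order_trans[OF norm_Pair_le add_mono])
  with assms show ?thesis by (intro L_infinityI) (auto simp: L_infinity_def)
qed

lemma L_infinity_If:
  assumes "f \<in> L_infinity M" "g \<in> L_infinity M" "A \<in> sets M"
  shows "(\<lambda>\<omega>. if \<omega> \<in> A then f \<omega> else g \<omega>) \<in> L_infinity M"
proof -
  obtain a b where "AE \<omega> in M. norm (f \<omega>) \<le> a" "AE \<omega> in M. norm (g \<omega>) \<le> b"
    using assms by (auto simp: L_infinity_def)
  then have "AE \<omega> in M. norm (if \<omega> \<in> A then f \<omega> else g \<omega>) \<le> max a b"
    by eventually_elim auto
  moreover have "(\<lambda>\<omega>. if \<omega> \<in> A then f \<omega> else g \<omega>) \<in> borel_measurable M"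
    using assms by (intro measurable_If_set) (auto simp: L_infinity_def)
  ultimately show ?thesis by (intro L_infinityI)
qed

lemma subspace_L_infinity: "subspace (L_infinity M)"
  by (simp add: subspace_def zero_fun_def plus_fun_def scaleR_fun_def
      L_infinity_const L_infinity_add L_infinity_scaleR)

text \<open>\<open>\<rho>\<close> is the price of requiring the first component not to depend on
  \<omega>. \<open>C1\<close> and \<open>J\<close> concern the deterministic copy of that component
  alone, which is why the pointwise problem ranges over all of X1.\<close>

proposition nonanticipativity_multiplier:
  fixes \<phi> :: "'x1::{reflexive_banach, second_countable_topology} \<times> 'x2::{banach, second_countable_topology} \<Rightarrow> 'm \<Rightarrow> real"
  assumes \<phi>: "dominated_integrand M \<phi>" and \<phi>_conv: "AE \<omega> in M. convex_on UNIV (\<lambda>z. \<phi> z \<omega>)"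
    and C: "convex C1" "convex C2" and J: "convex_on UNIV J"
    and xb1: "xb1 \<in> C1" and xb2: "xb2 \<in> L_infinity M" "AE \<omega> in M. xb2 \<omega> \<in> C2"
    and min: "\<And>x1 x2. \<lbrakk>x1 \<in> C1; x2 \<in> L_infinity M; AE \<omega> in M. x2 \<omega> \<in> C2\<rbrakk> \<Longrightarrow>
      J xb1 + (LINT \<omega>|M. \<phi> (xb1, xb2 \<omega>) \<omega>) \<le> J x1 + (LINT \<omega>|M. \<phi> (x1, x2 \<omega>) \<omega>)"
  obtains \<rho> :: "'m \<Rightarrow> 'x1 \<Rightarrow>\<^sub>L real" where "integrable M \<rho>"
    "\<And>x1. x1 \<in> C1 \<Longrightarrow> J xb1 + integral\<^sup>L M \<rho> xb1 \<le> J x1 + integral\<^sup>L M \<rho> x1"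
    "AE \<omega> in M. \<forall>x1. \<forall>x2\<in>C2. \<phi> (xb1, xb2 \<omega>) \<omega> - \<rho> \<omega> xb1 \<le> \<phi> (x1, x2) \<omega> - \<rho> \<omega> x1"
proof -
  interpret dominated_integrand M \<phi> by fact
  define X where "X = {(x1, x2). x1 \<in> C1 \<and> x2 \<in> L_infinity M \<and> (AE \<omega> in M. x2 \<omega> \<in> C2)}"
  \<comment> \<open>The perturbation \<open>v\<close> shifts the first argument under the integral
    only; the original problem is the case v = 0.\<close>
  define \<Psi> where "\<Psi> = (\<lambda>(x1, x2) v. J x1 + (LINT \<omega>|M. \<phi> (x1 + v \<omega>, x2 \<omega>) \<omega>))"
  have int: "integrable M (\<lambda>\<omega>. \<phi> (x1 + v \<omega>, x2 \<omega>) \<omega>)"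
    if "x2 \<in> L_infinity M" "v \<in> L_infinity M" for x1 x2 v
    using that by (intro integrable_comp L_infinity_Pair L_infinity_add L_infinity_const)
  have xbX: "(xb1, xb2) \<in> X" using xb1 xb2 by (simp add: X_def)
  obtain G where G: "linear G" "\<And>x v. x \<in> X \<Longrightarrow> v \<in> L_infinity M \<Longrightarrow> \<Psi> (xb1, xb2) 0 + G v \<le> \<Psi> x v"
  proof (rule subgradient_of_marginal[OF subspace_L_infinity xbX, of \<Psi>])
    show "\<Psi> (xb1, xb2) 0 \<le> \<Psi> x 0" if "x \<in> X" for x
      using that min by (auto simp: \<Psi>_def X_def)
  next
    fix x y and v w :: "'m \<Rightarrow> 'x1" and a b :: real
    assume xy: "x \<in> X" "y \<in> X" and vw: "v \<in> L_infinity M" "w \<in> L_infinity M" and ab: "0 < a" "0 < b" "a + b = 1"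
    obtain x1 x2 y1 y2 where x: "x = (x1, x2)" and y: "y = (y1, y2)" by (cases x, cases y)
    define z1 where "z1 = a *\<^sub>R x1 + b *\<^sub>R y1"
    define z2 where "z2 = (\<lambda>\<omega>. a *\<^sub>R x2 \<omega> + b *\<^sub>R y2 \<omega>)"
    have x': "x1 \<in> C1" "x2 \<in> L_infinity M" "AE \<omega> in M. x2 \<omega> \<in> C2"
      and y': "y1 \<in> C1" "y2 \<in> L_infinity M" "AE \<omega> in M. y2 \<omega> \<in> C2"
      using xy by (auto simp: x y X_def)
    have "AE \<omega> in M. z2 \<omega> \<in> C2"
      using x'(3) y'(3) by eventually_elim (use C(2) ab in \<open>simp add: z2_def convexD\<close>)
    moreover have z2: "z2 \<in> L_infinity M"
      unfolding z2_def by (intro L_infinity_add L_infinity_scaleR x' y')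
    ultimately have "(z1, z2) \<in> X"
      using C(1) ab x'(1) y'(1) by (simp add: X_def z1_def convexD)
    moreover have "\<Psi> (z1, z2) (a *\<^sub>R v + b *\<^sub>R w) \<le> a * \<Psi> x v + b * \<Psi> y w"
    proof -
      have "(LINT \<omega>|M. \<phi> (z1 + (a *\<^sub>R v + b *\<^sub>R w) \<omega>, z2 \<omega>) \<omega>) \<le>
          (LINT \<omega>|M. a * \<phi> (x1 + v \<omega>, x2 \<omega>) \<omega> + b * \<phi> (y1 + w \<omega>, y2 \<omega>) \<omega>)"
      proof (rule integral_mono_AE)
        show "integrable M (\<lambda>\<omega>. \<phi> (z1 + (a *\<^sub>R v + b *\<^sub>R w) \<omega>, z2 \<omega>) \<omega>)"
          by (intro int z2 subspace_add subspace_scale subspace_L_infinity vw)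
        show "AE \<omega> in M. \<phi> (z1 + (a *\<^sub>R v + b *\<^sub>R w) \<omega>, z2 \<omega>) \<omega> \<le>
            a * \<phi> (x1 + v \<omega>, x2 \<omega>) \<omega> + b * \<phi> (y1 + w \<omega>, y2 \<omega>) \<omega>"
          using \<phi>_conv
        proof eventually_elim
          case (elim \<omega>)
          have "(z1 + (a *\<^sub>R v + b *\<^sub>R w) \<omega>, z2 \<omega>) = a *\<^sub>R (x1 + v \<omega>, x2 \<omega>) + b *\<^sub>R (y1 + w \<omega>, y2 \<omega>)"
            by (simp add: z1_def z2_def scaleR_fun_def scaleR_add_right)
          with elim ab show ?case unfolding convex_on_def by simp
        qed
      qed (use int x' y' vw in simp)
      also have "\<dots> = a * (LINT \<omega>|M. \<phi> (x1 + v \<omega>, x2 \<omega>) \<omega>) + b * (LINT \<omega>|M. \<phi> (y1 + w \<omega>, y2 \<omega>) \<omega>)"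
        using int x' y' vw by simp
      moreover have "J z1 \<le> a * J x1 + b * J y1"
        using J ab unfolding z1_def convex_on_def by simp
      ultimately show ?thesis by (simp add: \<Psi>_def x y distrib_left)
    qed
    ultimately show "\<exists>z\<in>X. \<Psi> z (a *\<^sub>R v + b *\<^sub>R w) \<le> a * \<Psi> x v + b * \<Psi> y w" by blast
  qed (rule that)
  define \<iota> where "\<iota> A x = (\<lambda>\<omega>. indicator A \<omega> *\<^sub>R x)" for A :: "'m set" and x :: 'x1
  have \<iota>: "\<iota> A x \<in> L_infinity M" if "A \<in> sets M" for A x
    using that by (intro L_infinityI[where c = "norm x"]) (auto simp: \<iota>_def indicator_def)
  have \<iota>_scale: "G (\<iota> A (r *\<^sub>R x)) = r * G (\<iota> A x)" for A r x
  proof -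
    have "\<iota> A (r *\<^sub>R x) = r *\<^sub>R \<iota> A x" by (simp add: \<iota>_def scaleR_fun_def fun_eq_iff)
    then show ?thesis using linear_scale[OF G(1)] by simp
  qed
  have lin: "linear (\<lambda>x. G (\<iota> A x))" for A
  proof (rule linearI)
    fix x y
    have "\<iota> A (x + y) = \<iota> A x + \<iota> A y" by (simp add: \<iota>_def fun_eq_iff scaleR_add_right)
    then show "G (\<iota> A (x + y)) = G (\<iota> A x) + G (\<iota> A y)" using linear_add[OF G(1)] by simp
  qed (simp add: \<iota>_scale)
  obtain r where r: "AE \<omega> in M. norm (xb2 \<omega>) \<le> r" using xb2(1) by (auto simp: L_infinity_def)
  \<comment> \<open>The radius covers \<open>(xb1, xb2 \<omega>)\<close> and also
    \<open>(xb1 + x, xb2 \<omega>)\<close> for \<open>norm x \<le> 1\<close>.\<close>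
  obtain c where c: "integrable M c" "\<And>\<omega>. 0 \<le> c \<omega>"
      "AE \<omega> in M. \<forall>z. norm z \<le> norm xb1 + 1 + r \<longrightarrow> \<bar>\<phi> z \<omega>\<bar> \<le> c \<omega>"
    using dominated[of "norm xb1 + 1 + r"] by blast
  \<comment> \<open>The perturbation changes the integrand on \<open>A\<close> only, by at most
    \<open>2 * c\<close>. A bound by an integral over \<open>A\<close> is what
    \<open>dual_Radon_Nikodym\<close> requires.\<close>
  have G_le: "G (\<iota> A x) \<le> (LINT \<omega>|M. indicator A \<omega> * (2 * c \<omega>))" if A: "A \<in> sets M" and x: "norm x \<le> 1" for A x
  proof -
    have "G (\<iota> A x) \<le> \<Psi> (xb1, xb2) (\<iota> A x) - \<Psi> (xb1, xb2) 0" using G(2)[OF xbX \<iota>[OF A, of x]] by simp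
    also have "\<dots> = (LINT \<omega>|M. \<phi> (xb1 + \<iota> A x \<omega>, xb2 \<omega>) \<omega> - \<phi> (xb1 + 0, xb2 \<omega>) \<omega>)"
      using int[OF xb2(1) \<iota>[OF A], of xb1 x] int[OF xb2(1) L_infinity_const, of xb1 0]
      by (simp add: \<Psi>_def)
    also have "\<dots> \<le> (LINT \<omega>|M. indicator A \<omega> * (2 * c \<omega>))"
    proof (rule integral_mono_AE)
      show "integrable M (\<lambda>\<omega>. \<phi> (xb1 + \<iota> A x \<omega>, xb2 \<omega>) \<omega> - \<phi> (xb1 + 0, xb2 \<omega>) \<omega>)"
        by (intro Bochner_Integration.integrable_diff int xb2(1) \<iota>[OF A] L_infinity_const)
      show "integrable M (\<lambda>\<omega>. indicator A \<omega> * (2 * c \<omega>))"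
        using c(1) A by (intro integrable_indicator_mult) auto
      show "AE \<omega> in M. \<phi> (xb1 + \<iota> A x \<omega>, xb2 \<omega>) \<omega> - \<phi> (xb1 + 0, xb2 \<omega>) \<omega> \<le> indicator A \<omega> * (2 * c \<omega>)"
        using r c(3)
      proof eventually_elim
        case (elim \<omega>)
        show ?case
        proof (cases "\<omega> \<in> A")
          case True
          have "norm (xb1 + x, xb2 \<omega>) \<le> norm xb1 + 1 + r" "norm (xb1, xb2 \<omega>) \<le> norm xb1 + 1 + r"
            using norm_Pair_le[of "xb1 + x" "xb2 \<omega>"] norm_Pair_le[of xb1 "xb2 \<omega>"]
              norm_triangle_ineq[of xb1 x] x elim(1) by linarith+
          with elim(2) have "\<bar>\<phi> (xb1 + x, xb2 \<omega>) \<omega>\<bar> \<le> c \<omega>" "\<bar>\<phi> (xb1, xb2 \<omega>) \<omega>\<bar> \<le> c \<omega>" by blast+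
          with True show ?thesis by (simp add: \<iota>_def)
        qed (simp add: \<iota>_def)
      qed
    qed
    finally show ?thesis .
  qed
  obtain \<rho> :: "'m \<Rightarrow> 'x1 \<Rightarrow>\<^sub>L real" where int\<rho>: "integrable M \<rho>"
    and \<rho>: "\<And>A x. A \<in> sets M \<Longrightarrow> G (\<iota> A x) = (LINT \<omega>|M. indicator A \<omega> * \<rho> \<omega> x)"
  proof (rule dual_Radon_Nikodym[of "\<lambda>\<omega>. 2 * c \<omega>" "\<lambda>A x. G (\<iota> A x)"])
    show "G (\<iota> (A \<union> B) x) = G (\<iota> A x) + G (\<iota> B x)" if "A \<inter> B = {}" for A B x
    proof -
      have "\<iota> (A \<union> B) x = \<iota> A x + \<iota> B x" using that by (auto simp: \<iota>_def fun_eq_iff indicator_def)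
      then show ?thesis using linear_add[OF G(1)] by simp
    qed
    show "\<bar>G (\<iota> A x)\<bar> \<le> norm x * (LINT \<omega>|M. indicator A \<omega> * (2 * c \<omega>))" if A: "A \<in> sets M" for A x
    proof -
      \<comment> \<open>Scaling to unit norm gives the one-sided estimate; using it at
        \<open>x\<close> and \<open>- x\<close> gives the absolute value.\<close>
      have le: "G (\<iota> A y) \<le> norm y * (LINT \<omega>|M. indicator A \<omega> * (2 * c \<omega>))" for y
      proof (cases "y = 0")
        case True then show ?thesis using linear_0[OF lin] by simp
      next
        case False
        have "G (\<iota> A y) = norm y * G (\<iota> A (inverse (norm y) *\<^sub>R y))" using False by (simp add: \<iota>_scale)
        also have "\<dots> \<le> norm y * (LINT \<omega>|M. indicator A \<omega> * (2 * c \<omega>))"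
          using False by (intro mult_left_mono G_le A) auto
        finally show ?thesis .
      qed
      show ?thesis using le[of x] le[of "- x"] linear_neg[OF lin, of A x] by (simp add: abs_le_iff)
    qed
    show "integrable M (\<lambda>\<omega>. 2 * c \<omega>)" "0 \<le> 2 * c \<omega>" for \<omega> using c by auto
    show "linear (\<lambda>x. G (\<iota> A x))" for A by (rule lin)
  qed (rule that)
  have int\<rho>x: "integrable M (\<lambda>\<omega>. \<rho> \<omega> x)" for x
    by (rule integrable_bounded_linear[OF blinfun.bounded_linear_left int\<rho>])
  have E\<rho>: "integral\<^sup>L M \<rho> x = (LINT \<omega>|M. \<rho> \<omega> x)" for x
    by (rule integral_bounded_linear[OF blinfun.bounded_linear_left int\<rho>, symmetric])
  have key: "J xb1 + (LINT \<omega>|M. \<phi> (xb1, xb2 \<omega>) \<omega>) + (LINT \<omega>|M. indicator A \<omega> * \<rho> \<omega> x) \<le>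
      J x1 + (LINT \<omega>|M. \<phi> (x1 + indicator A \<omega> *\<^sub>R x, x2 \<omega>) \<omega>)"
    if "x1 \<in> C1" "x2 \<in> L_infinity M" "AE \<omega> in M. x2 \<omega> \<in> C2" "A \<in> sets M" for x1 x2 A x
    using G(2)[of "(x1, x2)", OF _ \<iota>[OF that(4)], of x] that
    unfolding \<rho>[OF that(4), symmetric] by (simp add: X_def \<Psi>_def \<iota>_def)
  have "J xb1 + integral\<^sup>L M \<rho> xb1 \<le> J x1 + integral\<^sup>L M \<rho> x1" if "x1 \<in> C1" for x1
  proof -
    \<comment> \<open>The constant shift \<open>xb1 - x1\<close> moves the argument back to
      \<open>xb1\<close>, so in \<open>key\<close> the integrals of \<phi> cancel.\<close>
    have "(LINT \<omega>|M. \<phi> (x1 + indicator (space M) \<omega> *\<^sub>R (xb1 - x1), xb2 \<omega>) \<omega>) = (LINT \<omega>|M. \<phi> (xb1, xb2 \<omega>) \<omega>)"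
      by (intro Bochner_Integration.integral_cong) auto
    moreover have "(LINT \<omega>|M. indicator (space M) \<omega> * \<rho> \<omega> (xb1 - x1)) = integral\<^sup>L M \<rho> (xb1 - x1)"
      unfolding E\<rho> by (intro Bochner_Integration.integral_cong) auto
    ultimately show ?thesis
      using key[OF that xb2 sets.top, of "xb1 - x1"] by (simp add: blinfun.diff_right)
  qed
  moreover have "AE \<omega> in M. \<forall>x1. \<forall>x2\<in>C2. \<phi> (xb1, xb2 \<omega>) \<omega> - \<rho> \<omega> xb1 \<le> \<phi> (x1, x2) \<omega> - \<rho> \<omega> x1"
  proof -
    define h where "h z \<omega> = \<phi> z \<omega> - \<rho> \<omega> (fst z)" for z \<omega>
    have "AE \<omega> in M. 0 \<le> h (d1, d2) \<omega> - h (xb1, xb2 \<omega>) \<omega>" if d2: "d2 \<in> C2" for d1 d2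
    proof (rule AE_nonneg_integralI)
      have \<phi>d: "integrable M (\<phi> (d1, d2))" using integrable_comp[OF L_infinity_const] by simp
      have \<phi>b: "integrable M (\<lambda>\<omega>. \<phi> (xb1, xb2 \<omega>) \<omega>)"
        by (intro integrable_comp L_infinity_Pair L_infinity_const xb2)
      show "integrable M (\<lambda>\<omega>. h (d1, d2) \<omega> - h (xb1, xb2 \<omega>) \<omega>)"
        unfolding h_def using \<phi>d \<phi>b int\<rho>x by simp
      fix A assume A: "A \<in> sets M"
      \<comment> \<open>On \<open>A\<close> both components jump to \<open>(d1, d2)\<close>, the
        first through the perturbation and the second through this choice; elsewhere nothing
        changes. The deterministic component stays \<open>xb1\<close>, so \<open>J\<close>
        cancels.\<close>
      define x2 where "x2 \<omega> = (if \<omega> \<in> A then d2 else xb2 \<omega>)" for \<omega>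
      have x2: "x2 \<in> L_infinity M"
        unfolding x2_def by (intro L_infinity_If L_infinity_const xb2 A)
      have x2C: "AE \<omega> in M. x2 \<omega> \<in> C2" using xb2(2) by eventually_elim (simp add: x2_def d2)
      have int1: "integrable M (\<lambda>\<omega>. \<phi> (xb1 + indicator A \<omega> *\<^sub>R (d1 - xb1), x2 \<omega>) \<omega>)"
        using int[OF x2 \<iota>[OF A]] by (simp add: \<iota>_def)
      have "0 \<le> (LINT \<omega>|M. \<phi> (xb1 + indicator A \<omega> *\<^sub>R (d1 - xb1), x2 \<omega>) \<omega>) -
          (LINT \<omega>|M. \<phi> (xb1, xb2 \<omega>) \<omega>) - (LINT \<omega>|M. indicator A \<omega> * \<rho> \<omega> (d1 - xb1))"
        using key[OF xb1 x2 x2C A, of "d1 - xb1"] by simp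
      also have "\<dots> = (LINT \<omega>|M. \<phi> (xb1 + indicator A \<omega> *\<^sub>R (d1 - xb1), x2 \<omega>) \<omega> -
          \<phi> (xb1, xb2 \<omega>) \<omega> - indicator A \<omega> * \<rho> \<omega> (d1 - xb1))"
        using int1 \<phi>b int\<rho>x A by (simp add: integrable_indicator_mult)
      also have "\<dots> = (LINT \<omega>|M. indicator A \<omega> * (h (d1, d2) \<omega> - h (xb1, xb2 \<omega>) \<omega>))"
        by (intro Bochner_Integration.integral_cong refl)
          (auto simp: h_def x2_def indicator_def blinfun.diff_right)
      finally show "0 \<le> (LINT \<omega>|M. indicator A \<omega> * (h (d1, d2) \<omega> - h (xb1, xb2 \<omega>) \<omega>))" .
    qed
    \<comment> \<open>Competitors from a countable dense set share one null set; continuity of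
      \<open>h\<close> then reaches the remaining ones.\<close>
    moreover obtain D :: "('x1 \<times> 'x2) set" where D: "countable D" "D \<subseteq> UNIV \<times> C2" "UNIV \<times> C2 \<subseteq> closure D"
      using separable by metis
    ultimately have "AE \<omega> in M. \<forall>d\<in>D. 0 \<le> h d \<omega> - h (xb1, xb2 \<omega>) \<omega>"
      by (subst AE_ball_countable) auto
    with AE_space show ?thesis
    proof eventually_elim
      case (elim \<omega>)
      have "continuous_on UNIV (\<lambda>z. h z \<omega>)"
        unfolding h_def using cont[OF elim(1)] by (intro continuous_intros)
      then have "closed {z. h (xb1, xb2 \<omega>) \<omega> \<le> h z \<omega>}"
        by (intro closed_Collect_le continuous_on_const)
      moreover have "D \<subseteq> {z. h (xb1, xb2 \<omega>) \<omega> \<le> h z \<omega>}" using elim(2) by auto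
      ultimately have "closure D \<subseteq> {z. h (xb1, xb2 \<omega>) \<omega> \<le> h z \<omega>}"
        by (rule closure_minimal[rotated])
      with D(3) have "UNIV \<times> C2 \<subseteq> {z. h (xb1, xb2 \<omega>) \<omega> \<le> h z \<omega>}" by (rule order_trans)
      then have "h (xb1, xb2 \<omega>) \<omega> \<le> h (x1, x2) \<omega>" if "x2 \<in> C2" for x1 x2
        using that by auto
      then show ?case by (simp add: h_def)
    qed
  qed
  ultimately show thesis using that[OF int\<rho>] by blast
qed

section \<open>Saddle points of the Lagrangian\<close>

text \<open>This supplies the continuity of \<open>J2\<close>, for which the basic assumption states
  only convexity and local bounds.\<close>

lemma continuous_on_convex_bounded_on_balls:
  fixes f :: "'a::real_normed_vector \<Rightarrow> real"
  assumes conv: "convex_on UNIV f" and bdd: "\<And>r. \<exists>b. \<forall>x. norm x \<le> r \<longrightarrow> \<bar>f x\<bar> \<le> b"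
  shows "continuous_on UNIV f"
proof -
  have "isCont f x" for x
  proof -
    obtain b where b: "\<forall>y. norm y \<le> norm x + 1 \<longrightarrow> \<bar>f y\<bar> \<le> b" using bdd by blast
    have "continuous_on (ball 0 (norm x + 1)) f"
    proof (rule convex_on_bounded_continuous)
      show "convex_on (ball 0 (norm x + 1)) f" using conv by (rule convex_on_subset) auto
      show "\<forall>y\<in>ball 0 (norm x + 1). \<bar>f y\<bar> \<le> b" using b by auto
    qed simp
    then show ?thesis by (simp add: continuous_on_eq_continuous_at)
  qed
  then show ?thesis by (simp add: continuous_on_eq_continuous_at)
qed

lemma borel_measurable_blinfun_pairing:
  fixes l :: "'m \<Rightarrow> 'w::{reflexive_banach, second_countable_topology} \<Rightarrow>\<^sub>L real"
  assumes "l \<in> borel_measurable M" "h \<in> borel_measurable M"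
  shows "(\<lambda>\<omega>. l \<omega> (h \<omega>)) \<in> borel_measurable M"
  using assms by (rule borel_measurable_continuous_Pair) (intro continuous_intros)

lemma abs_blinfun_le: "norm h \<le> b \<Longrightarrow> \<bar>blinfun_apply l h\<bar> \<le> b * norm l"
  using norm_blinfun[of l h] mult_left_mono[of "norm h" b "norm l"] by (simp add: mult.commute)

lemma integrable_pairing:
  fixes l :: "'m \<Rightarrow> 'w::{reflexive_banach, second_countable_topology} \<Rightarrow>\<^sub>L real"
  assumes l: "integrable M l" and h: "h \<in> L_infinity M"
  shows "integrable M (\<lambda>\<omega>. l \<omega> (h \<omega>))"
proof -
  obtain b where b: "AE \<omega> in M. norm (h \<omega>) \<le> b" using h by (auto simp: L_infinity_def)
  show ?thesis
  proof (rule Bochner_Integration.integrable_bound)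
    show "integrable M (\<lambda>\<omega>. b * norm (l \<omega>))" using l by simp
    show "(\<lambda>\<omega>. l \<omega> (h \<omega>)) \<in> borel_measurable M"
      using l h by (intro borel_measurable_blinfun_pairing) (auto simp: L_infinity_def)
    show "AE \<omega> in M. norm (l \<omega> (h \<omega>)) \<le> norm (b * norm (l \<omega>))"
      using b
    proof eventually_elim
      case (elim \<omega>)
      then show ?case using abs_blinfun_le[of "h \<omega>" b "l \<omega>"] by simp
    qed
  qed
qed

lemma L_infinity_Caratheodory:
  fixes f :: "'z::{banach, second_countable_topology} \<Rightarrow> 'm \<Rightarrow> 'b::{banach, second_countable_topology}"
  assumes cont: "\<And>\<omega>. \<omega> \<in> space M \<Longrightarrow> continuous_on UNIV (\<lambda>z. f z \<omega>)"
    and meas: "\<And>z. f z \<in> borel_measurable M"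
    and bdd: "\<And>r. \<exists>b. AE \<omega> in M. \<forall>z. norm z \<le> r \<longrightarrow> norm (f z \<omega>) \<le> b"
    and z: "z \<in> L_infinity M"
  shows "(\<lambda>\<omega>. f (z \<omega>) \<omega>) \<in> L_infinity M"
proof -
  obtain r where "AE \<omega> in M. norm (z \<omega>) \<le> r" using z by (auto simp: L_infinity_def)
  moreover obtain b where "AE \<omega> in M. \<forall>z. norm z \<le> r \<longrightarrow> norm (f z \<omega>) \<le> b"
    using bdd by blast
  ultimately have "AE \<omega> in M. norm (f (z \<omega>) \<omega>) \<le> b"
    by eventually_elim blast
  moreover have "(\<lambda>\<omega>. f (z \<omega>) \<omega>) \<in> borel_measurable M"
    using z by (intro borel_measurable_Caratheodory[OF cont meas]) (auto simp: L_infinity_def)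
  ultimately show ?thesis by (intro L_infinityI)
qed

text \<open>Uncurried, since \<open>dominated_integrand\<close> treats the decision as one point of
  a product space.\<close>

definition lagrangian_integrand where
  "lagrangian_integrand J2 e i le li = (\<lambda>(x1, x2) \<omega>. J2 x1 x2 + blinfun_apply (le \<omega>) (e x1 x2 \<omega>) + blinfun_apply (li \<omega>) (i x1 x2 \<omega>))"

section \<open>Regularity and convexity of the Lagrangian integrand\<close>

locale basic_problem = prob_space M for M :: "'m measure" +
  fixes C1 :: "'x1::{reflexive_banach, second_countable_topology} set"
    and C2 :: "'x2::{reflexive_banach, second_countable_topology} set"
    and K :: "'r::{reflexive_banach, second_countable_topology} set"
    and J1 :: "'x1 \<Rightarrow> real"
    and J2 :: "'x1 \<Rightarrow> 'x2 \<Rightarrow> real"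
    and e :: "'x1 \<Rightarrow> 'x2 \<Rightarrow> 'm \<Rightarrow> 'w::{reflexive_banach, second_countable_topology}"
    and i :: "'x1 \<Rightarrow> 'x2 \<Rightarrow> 'm \<Rightarrow> 'r"
  assumes basic: "basic_assumption M C1 C2 K J1 J2 e i"
begin

abbreviation "\<phi> \<equiv> lagrangian_integrand J2 e i"
abbreviation "\<L> \<equiv> lagrangian M C1 C2 K J1 J2 e i"

lemma data_sets: "C1 \<noteq> {}" "convex C1" "C2 \<noteq> {}" "convex C2" "K \<noteq> {}" "closed K" "convex K" "cone K"
  and J1_convex: "convex_on UNIV J1"
  and J2_convex: "convex_on UNIV (\<lambda>z. J2 (fst z) (snd z))"
  and e_linear: "\<omega> \<in> space M \<Longrightarrow> linear (\<lambda>z. e (fst z) (snd z) \<omega>)"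
  and i_convex: "\<omega> \<in> space M \<Longrightarrow> cone_convex K (\<lambda>z. i (fst z) (snd z) \<omega>)"
  and e_continuous: "\<omega> \<in> space M \<Longrightarrow> continuous_on UNIV (\<lambda>z. e (fst z) (snd z) \<omega>)"
  and i_continuous: "\<omega> \<in> space M \<Longrightarrow> continuous_on UNIV (\<lambda>z. i (fst z) (snd z) \<omega>)"
  and e_measurable: "e x1 x2 \<in> borel_measurable M"
  and i_measurable: "i x1 x2 \<in> borel_measurable M"
  and J2_bound: "0 < r \<Longrightarrow> \<exists>b>0. \<forall>x1 x2. norm x1 + norm x2 \<le> r \<longrightarrow> \<bar>J2 x1 x2\<bar> \<le> b"
  and e_bound: "0 < r \<Longrightarrow> \<exists>b>0. \<forall>x1 x2. norm x1 + norm x2 \<le> r \<longrightarrow> (AE \<omega> in M. norm (e x1 x2 \<omega>) \<le> b)"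
  and i_bound: "0 < r \<Longrightarrow> \<exists>b>0. \<forall>x1 x2. norm x1 + norm x2 \<le> r \<longrightarrow> (AE \<omega> in M. norm (i x1 x2 \<omega>) \<le> b)"
  using basic by (simp_all add: basic_assumption_def split_beta')

text \<open>Passes from the product norm to the sum of norms in the basic assumption. The summand 1
  keeps the radius positive, as those bounds demand.\<close>

lemma norm_parts_le: "norm (z :: 'x1 \<times> 'x2) \<le> r \<Longrightarrow> norm (fst z) + norm (snd z) \<le> 2 * \<bar>r\<bar> + 1"
  using norm_fst_le[of "fst z" "snd z"] norm_snd_le[of "snd z" "fst z"] by simp

lemma J2_bounded: "\<exists>b. \<forall>z. norm z \<le> r \<longrightarrow> \<bar>J2 (fst z) (snd z)\<bar> \<le> b"
proof -
  have "2 * \<bar>r\<bar> + 1 > 0" by simp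
  then obtain b where "\<forall>x1 x2. norm x1 + norm x2 \<le> 2 * \<bar>r\<bar> + 1 \<longrightarrow> \<bar>J2 x1 x2\<bar> \<le> b"
    using J2_bound by blast
  then show ?thesis using norm_parts_le by blast
qed

lemma e_bounded: "\<exists>b. AE \<omega> in M. \<forall>z. norm z \<le> r \<longrightarrow> norm (e (fst z) (snd z) \<omega>) \<le> b"
proof -
  have "2 * \<bar>r\<bar> + 1 > 0" by simp
  then obtain b where b: "\<forall>x1 x2. norm x1 + norm x2 \<le> 2 * \<bar>r\<bar> + 1 \<longrightarrow> (AE \<omega> in M. norm (e x1 x2 \<omega>) \<le> b)"
    using e_bound by blast
  have "AE \<omega> in M. \<forall>z\<in>{z. norm z \<le> r}. norm (e (fst z) (snd z) \<omega>) \<le> b"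
    using b norm_parts_le by (intro AE_norm_le_uniform e_continuous) auto
  then show ?thesis by auto
qed

lemma i_bounded: "\<exists>b. AE \<omega> in M. \<forall>z. norm z \<le> r \<longrightarrow> norm (i (fst z) (snd z) \<omega>) \<le> b"
proof -
  have "2 * \<bar>r\<bar> + 1 > 0" by simp
  then obtain b where b: "\<forall>x1 x2. norm x1 + norm x2 \<le> 2 * \<bar>r\<bar> + 1 \<longrightarrow> (AE \<omega> in M. norm (i x1 x2 \<omega>) \<le> b)"
    using i_bound by blast
  have "AE \<omega> in M. \<forall>z\<in>{z. norm z \<le> r}. norm (i (fst z) (snd z) \<omega>) \<le> b"
    using b norm_parts_le by (intro AE_norm_le_uniform i_continuous) auto
  then show ?thesis by auto
qed

lemma e_L_infinity: "z \<in> L_infinity M \<Longrightarrow> (\<lambda>\<omega>. e (fst (z \<omega>)) (snd (z \<omega>)) \<omega>) \<in> L_infinity M"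
  by (rule L_infinity_Caratheodory[OF e_continuous e_measurable e_bounded])

lemma i_L_infinity: "z \<in> L_infinity M \<Longrightarrow> (\<lambda>\<omega>. i (fst (z \<omega>)) (snd (z \<omega>)) \<omega>) \<in> L_infinity M"
  by (rule L_infinity_Caratheodory[OF i_continuous i_measurable i_bounded])

lemma J2_continuous: "continuous_on UNIV (\<lambda>z. J2 (fst z) (snd z))"
  by (rule continuous_on_convex_bounded_on_balls[OF J2_convex J2_bounded])

lemma dominated_integrand_lagrangian:
  assumes le: "integrable M le" and li: "integrable M li"
  shows "dominated_integrand M (\<phi> le li)"
proof
  show "continuous_on UNIV (\<lambda>z. \<phi> le li z \<omega>)" if "\<omega> \<in> space M" for \<omega>
    unfolding lagrangian_integrand_def split_beta'
    by (intro continuous_intros J2_continuous e_continuous i_continuous that)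
  show "\<phi> le li z \<in> borel_measurable M" for z
    unfolding lagrangian_integrand_def split_beta' using le li
    by (intro borel_measurable_add borel_measurable_const borel_measurable_blinfun_pairing
        e_measurable i_measurable) auto
  show "\<exists>c. integrable M c \<and> (\<forall>\<omega>. 0 \<le> c \<omega>) \<and> (AE \<omega> in M. \<forall>z. norm z \<le> r \<longrightarrow> \<bar>\<phi> le li z \<omega>\<bar> \<le> c \<omega>)" for r
  proof -
    obtain a be bi where a: "\<forall>z. norm z \<le> r \<longrightarrow> \<bar>J2 (fst z) (snd z)\<bar> \<le> a"
      and be: "AE \<omega> in M. \<forall>z. norm z \<le> r \<longrightarrow> norm (e (fst z) (snd z) \<omega>) \<le> be"
      and bi: "AE \<omega> in M. \<forall>z. norm z \<le> r \<longrightarrow> norm (i (fst z) (snd z) \<omega>) \<le> bi"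
      using J2_bounded[of r] e_bounded[of r] i_bounded[of r] by blast
    \<comment> \<open>Absolute values keep the envelope nonnegative even for r < 0, when the bounds
      are vacuous and may be negative.\<close>
    define c where "c \<omega> = \<bar>a\<bar> + \<bar>be\<bar> * norm (le \<omega>) + \<bar>bi\<bar> * norm (li \<omega>)" for \<omega>
    have "integrable M c" unfolding c_def using le li by simp
    moreover have "\<forall>\<omega>. 0 \<le> c \<omega>" by (simp add: c_def)
    moreover have "AE \<omega> in M. \<forall>z. norm z \<le> r \<longrightarrow> \<bar>\<phi> le li z \<omega>\<bar> \<le> c \<omega>"
      using be bi
    proof eventually_elim
      case (elim \<omega>)
      show ?case
      proof (intro allI impI)
        fix z :: "'x1 \<times> 'x2" assume z: "norm z \<le> r"
        have "\<bar>J2 (fst z) (snd z)\<bar> \<le> \<bar>a\<bar>" using a z by fastforce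
        moreover have "\<bar>le \<omega> (e (fst z) (snd z) \<omega>)\<bar> \<le> \<bar>be\<bar> * norm (le \<omega>)"
          using elim(1) z by (intro abs_blinfun_le) fastforce
        moreover have "\<bar>li \<omega> (i (fst z) (snd z) \<omega>)\<bar> \<le> \<bar>bi\<bar> * norm (li \<omega>)"
          using elim(2) z by (intro abs_blinfun_le) fastforce
        ultimately show "\<bar>\<phi> le li z \<omega>\<bar> \<le> c \<omega>"
          unfolding lagrangian_integrand_def c_def split_beta' by linarith
      qed
    qed
    ultimately show ?thesis by blast
  qed
qed

text \<open>Pairing with an element of the dual cone turns K-convexity into scalar convexity; the
  term with \<open>e\<close> is linear.\<close>

lemma convex_lagrangian_integrand:
  assumes \<omega>: "\<omega> \<in> space M" and li: "li \<omega> \<in> dual_cone K"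
  shows "convex_on UNIV (\<lambda>z. \<phi> le li z \<omega>)"
proof -
  have "convex_on UNIV (\<lambda>z. le \<omega> (e (fst z) (snd z) \<omega>))"
  proof (rule convex_onI)
    fix t :: real and z w :: "'x1 \<times> 'x2"
    show "le \<omega> (e (fst ((1 - t) *\<^sub>R z + t *\<^sub>R w)) (snd ((1 - t) *\<^sub>R z + t *\<^sub>R w)) \<omega>) \<le>
        (1 - t) * le \<omega> (e (fst z) (snd z) \<omega>) + t * le \<omega> (e (fst w) (snd w) \<omega>)"
      using linear_add[OF e_linear[OF \<omega>], of "(1 - t) *\<^sub>R z" "t *\<^sub>R w"]
        linear_scale[OF e_linear[OF \<omega>], of "1 - t" z] linear_scale[OF e_linear[OF \<omega>], of t w]
      by (simp add: blinfun.add_right blinfun.scaleR_right)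
  qed simp
  moreover have "convex_on UNIV (\<lambda>z. li \<omega> (i (fst z) (snd z) \<omega>))"
  proof (rule convex_onI)
    fix t :: real and z w :: "'x1 \<times> 'x2" assume t: "0 < t" "t < 1"
    define y where "y = (1 - t) *\<^sub>R z + t *\<^sub>R w"
    \<comment> \<open>The instance is at \<open>1 - t\<close>: \<open>cone_convex\<close> puts its
      parameter on the first point, \<open>convex_onI\<close> on the second.\<close>
    have "cone_le K (i (fst y) (snd y) \<omega>)
        ((1 - t) *\<^sub>R i (fst z) (snd z) \<omega> + t *\<^sub>R i (fst w) (snd w) \<omega>)"
      using i_convex[OF \<omega>, unfolded cone_convex_def, rule_format, where x = z and y = w and t = "1 - t"] t
      by (simp add: y_def)
    then have "0 \<le> li \<omega> ((1 - t) *\<^sub>R i (fst z) (snd z) \<omega> + t *\<^sub>R i (fst w) (snd w) \<omega> - i (fst y) (snd y) \<omega>)"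
      using li by (simp add: cone_le_def dual_cone_def)
    then show "li \<omega> (i (fst ((1 - t) *\<^sub>R z + t *\<^sub>R w)) (snd ((1 - t) *\<^sub>R z + t *\<^sub>R w)) \<omega>) \<le>
        (1 - t) * li \<omega> (i (fst z) (snd z) \<omega>) + t * li \<omega> (i (fst w) (snd w) \<omega>)"
      by (simp add: blinfun.add_right blinfun.diff_right blinfun.scaleR_right y_def)
  qed simp
  ultimately show ?thesis
    unfolding lagrangian_integrand_def split_beta'
    by (intro convex_on_add J2_convex)
qed

lemma lagrangian_eq:
  assumes "x1 \<in> C1" "x2 \<in> L_infinity M" "AE \<omega> in M. x2 \<omega> \<in> C2"
    and "integrable M le" "integrable M li" "AE \<omega> in M. li \<omega> \<in> dual_cone K"
  shows "\<L> (x1, x2) (le, li) = ereal (J1 x1 + (LINT \<omega>|M. \<phi> le li (x1, x2 \<omega>) \<omega>))"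
  using assms by (simp add: lagrangian_def X0_set_def X_space_def Lambda0_set_def Lambda_space_def
      lagrangian_integrand_def)

end

section \<open>Saddle point conditions at a fixed primal-dual pair\<close>

context basic_problem
begin

context
  fixes xb1 :: 'x1 and xb2 :: "'m \<Rightarrow> 'x2"
    and lbe :: "'m \<Rightarrow> 'w \<Rightarrow>\<^sub>L real" and lbi :: "'m \<Rightarrow> 'r \<Rightarrow>\<^sub>L real"
  assumes xb2: "xb2 \<in> L_infinity M" and lbe: "integrable M lbe" and lbi: "integrable M lbi"
begin

definition "e_bar = (\<lambda>\<omega>. e xb1 (xb2 \<omega>) \<omega>)"
definition "i_bar = (\<lambda>\<omega>. i xb1 (xb2 \<omega>) \<omega>)"

lemma e_bar: "e_bar \<in> L_infinity M" and i_bar: "i_bar \<in> L_infinity M"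
  using e_L_infinity[of "\<lambda>\<omega>. (xb1, xb2 \<omega>)"] i_L_infinity[of "\<lambda>\<omega>. (xb1, xb2 \<omega>)"]
    L_infinity_Pair[OF L_infinity_const xb2, of xb1]
  by (simp_all add: e_bar_def i_bar_def)

lemma integrable_\<phi>:
  assumes "integrable M le" "integrable M li" "x2 \<in> L_infinity M"
  shows "integrable M (\<lambda>\<omega>. \<phi> le li (x1, x2 \<omega>) \<omega>)"
  by (intro dominated_integrand.integrable_comp dominated_integrand_lagrangian L_infinity_Pair
      L_infinity_const assms)

lemma integral_\<phi>_bar:
  assumes "integrable M le" "integrable M li"
  shows "(LINT \<omega>|M. \<phi> le li (xb1, xb2 \<omega>) \<omega>) =
    (LINT \<omega>|M. J2 xb1 (xb2 \<omega>)) + (LINT \<omega>|M. le \<omega> (e_bar \<omega>)) + (LINT \<omega>|M. li \<omega> (i_bar \<omega>))"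
proof -
  have "integrable M (\<lambda>\<omega>. J2 xb1 (xb2 \<omega>))"
    using integrable_\<phi>[OF _ _ xb2, of "\<lambda>_. 0" "\<lambda>_. 0" xb1] by (simp add: lagrangian_integrand_def)
  then show ?thesis
    using integrable_pairing[OF assms(1) e_bar] integrable_pairing[OF assms(2) i_bar]
    by (simp add: lagrangian_integrand_def e_bar_def i_bar_def)
qed

text \<open>Comparison with a constant feasible decision excludes the value \<infinity>. Once the
  primal point is known to be feasible, comparison with the zero multiplier excludes the value
  \<open>- \<infinity>\<close>.\<close>

lemma saddle_point_feasible:
  assumes saddle: "saddle_point (X_space M) (Lambda_space M) \<L> (xb1, xb2) (lbe, lbi)"
  shows "xb1 \<in> C1" and "AE \<omega> in M. xb2 \<omega> \<in> C2" and "AE \<omega> in M. lbi \<omega> \<in> dual_cone K"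
proof -
  have 1: "\<L> (xb1, xb2) (lbe, lbi) \<le> \<L> x (lbe, lbi)" if "x \<in> X_space M" for x
    using saddle that by (auto simp: saddle_point_def)
  have 2: "\<L> (xb1, xb2) l \<le> \<L> (xb1, xb2) (lbe, lbi)" if "l \<in> Lambda_space M" for l
    using saddle that by (auto simp: saddle_point_def)
  obtain c1 c2 where c: "c1 \<in> C1" "c2 \<in> C2" using data_sets by auto
  have "(c1, \<lambda>_. c2) \<in> X0_set M C1 C2"
    using c by (simp add: X0_set_def X_space_def L_infinity_const)
  then have "\<L> (c1, \<lambda>_. c2) (lbe, lbi) \<noteq> \<infinity>" by (simp add: lagrangian_def)
  moreover have "(c1, \<lambda>_. c2) \<in> X_space M" by (simp add: X_space_def L_infinity_const)
  ultimately have "\<L> (xb1, xb2) (lbe, lbi) \<noteq> \<infinity>" using 1 by fastforce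
  then have X0: "(xb1, xb2) \<in> X0_set M C1 C2" by (auto simp: lagrangian_def split: if_splits)
  then show "xb1 \<in> C1" "AE \<omega> in M. xb2 \<omega> \<in> C2" by (auto simp: X0_set_def)
  have "(\<lambda>_. 0, \<lambda>_. 0) \<in> Lambda0_set M K"
    by (simp add: Lambda0_set_def Lambda_space_def dual_cone_def)
  then have "\<L> (xb1, xb2) (\<lambda>_. 0, \<lambda>_. 0) \<noteq> - \<infinity>" using X0 by (simp add: lagrangian_def)
  moreover have "(\<lambda>_. 0, \<lambda>_. 0) \<in> Lambda_space M" by (simp add: Lambda_space_def)
  ultimately have "\<L> (xb1, xb2) (lbe, lbi) \<noteq> - \<infinity>" using 2 by fastforce
  then have "(lbe, lbi) \<in> Lambda0_set M K" using X0 by (auto simp: lagrangian_def split: if_splits)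
  then show "AE \<omega> in M. lbi \<omega> \<in> dual_cone K" by (auto simp: Lambda0_set_def)
qed

text \<open>Only the two pairing terms depend on the multiplier, so the given multiplier maximizes
  their sum. Increments \<open>indicator A \<omega> *\<^sub>R t\<close> with \<open>t\<close> in the
  dual cone stay admissible and yield the inequality constraint.\<close>

lemma saddle_point_imp_constraints:
  assumes saddle: "saddle_point (X_space M) (Lambda_space M) \<L> (xb1, xb2) (lbe, lbi)"
  shows "AE \<omega> in M. e_bar \<omega> = 0" and "AE \<omega> in M. - i_bar \<omega> \<in> K" and "AE \<omega> in M. lbi \<omega> (i_bar \<omega>) = 0"
proof -
  note feas = saddle_point_feasible[OF saddle]
  have max: "(LINT \<omega>|M. le \<omega> (e_bar \<omega>)) + (LINT \<omega>|M. li \<omega> (i_bar \<omega>)) \<le>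
      (LINT \<omega>|M. lbe \<omega> (e_bar \<omega>)) + (LINT \<omega>|M. lbi \<omega> (i_bar \<omega>))"
    if l: "integrable M le" "integrable M li" "AE \<omega> in M. li \<omega> \<in> dual_cone K"
    for le :: "'m \<Rightarrow> 'w \<Rightarrow>\<^sub>L real" and li :: "'m \<Rightarrow> 'r \<Rightarrow>\<^sub>L real"
  proof -
    have "\<L> (xb1, xb2) (le, li) \<le> \<L> (xb1, xb2) (lbe, lbi)"
      using saddle l by (auto simp: saddle_point_def Lambda_space_def)
    then show ?thesis
      using feas l lbe lbi xb2 by (simp add: lagrangian_eq integral_\<phi>_bar)
  qed
  have ind: "integrable M (\<lambda>\<omega>. indicator A \<omega> *\<^sub>R t)" if "A \<in> sets M"
    for A and t :: "'c::{banach, second_countable_topology}"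
    using that by (intro integrable_mult_indicator) auto
  have integrable_L_infinity: "integrable M h" if "h \<in> L_infinity M"
    for h :: "'m \<Rightarrow> 'c::{banach, second_countable_topology}"
    using that by (auto simp: L_infinity_def intro: integrable_const_bound)
  \<comment> \<open>Equality is membership in the cone {0}, whose dual cone is the whole dual, so
    \<open>t\<close> is arbitrary.\<close>
  have "AE \<omega> in M. e_bar \<omega> \<in> {0}"
  proof (rule AE_mem_closed_coneI)
    fix t :: "'w \<Rightarrow>\<^sub>L real" and A assume A: "A \<in> sets M"
    let ?l = "\<lambda>\<omega>. indicator A \<omega> *\<^sub>R (- t)"
    have "(LINT \<omega>|M. (lbe \<omega> + ?l \<omega>) (e_bar \<omega>)) \<le> (LINT \<omega>|M. lbe \<omega> (e_bar \<omega>))"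
      using max[of "\<lambda>\<omega>. lbe \<omega> + ?l \<omega>" lbi] lbe lbi feas(3) ind[OF A, of "- t"] by simp
    moreover have "(LINT \<omega>|M. (lbe \<omega> + ?l \<omega>) (e_bar \<omega>)) = (LINT \<omega>|M. lbe \<omega> (e_bar \<omega>)) + (LINT \<omega>|M. ?l \<omega> (e_bar \<omega>))"
      unfolding blinfun.add_left
      by (intro Bochner_Integration.integral_add integrable_pairing lbe e_bar ind A)
    ultimately show "0 \<le> (LINT \<omega>|M. indicator A \<omega> * t (e_bar \<omega>))"
      by (simp add: blinfun.scaleR_left blinfun.minus_left)
  qed (simp_all add: cone_def integrable_L_infinity e_bar)
  then show "AE \<omega> in M. e_bar \<omega> = 0" by simp
  show K: "AE \<omega> in M. - i_bar \<omega> \<in> K"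
  proof (rule AE_mem_closed_coneI)
    fix t :: "'r \<Rightarrow>\<^sub>L real" and A assume t: "t \<in> dual_cone K" and A: "A \<in> sets M"
    let ?l = "\<lambda>\<omega>. indicator A \<omega> *\<^sub>R t"
    have "AE \<omega> in M. lbi \<omega> + ?l \<omega> \<in> dual_cone K"
      using feas(3) by eventually_elim
        (use t in \<open>auto simp: dual_cone_def blinfun.add_left blinfun.scaleR_left indicator_def\<close>)
    then have "(LINT \<omega>|M. (lbi \<omega> + ?l \<omega>) (i_bar \<omega>)) \<le> (LINT \<omega>|M. lbi \<omega> (i_bar \<omega>))"
      using max[of lbe "\<lambda>\<omega>. lbi \<omega> + ?l \<omega>"] lbe lbi ind[OF A, of t] by simp
    moreover have "(LINT \<omega>|M. (lbi \<omega> + ?l \<omega>) (i_bar \<omega>)) = (LINT \<omega>|M. lbi \<omega> (i_bar \<omega>)) + (LINT \<omega>|M. ?l \<omega> (i_bar \<omega>))"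
      unfolding blinfun.add_left
      by (intro Bochner_Integration.integral_add integrable_pairing lbi i_bar ind A)
    ultimately show "0 \<le> (LINT \<omega>|M. indicator A \<omega> * t (- i_bar \<omega>))"
      by (simp add: blinfun.scaleR_left blinfun.minus_right)
  qed (use data_sets integrable_L_infinity[OF i_bar] in simp_all)
  have int: "integrable M (\<lambda>\<omega>. - lbi \<omega> (i_bar \<omega>))" using integrable_pairing[OF lbi i_bar] by simp
  have nn: "AE \<omega> in M. 0 \<le> - lbi \<omega> (i_bar \<omega>)"
    using K feas(3) by eventually_elim (auto simp: dual_cone_def blinfun.minus_right dest!: bspec)
  \<comment> \<open>The zero multiplier bounds the integral from below while the integrand is
    nonpositive by \<open>nn\<close>; complementarity follows.\<close>
  have "0 \<le> (LINT \<omega>|M. lbi \<omega> (i_bar \<omega>))"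
    using max[of lbe "\<lambda>_. 0"] lbe by (simp add: dual_cone_def)
  then have "(LINT \<omega>|M. - lbi \<omega> (i_bar \<omega>)) = 0"
    using integral_nonneg_AE[OF nn] by simp
  then have "AE \<omega> in M. - lbi \<omega> (i_bar \<omega>) = 0"
    using integral_nonneg_eq_0_iff_AE[OF int nn] by simp
  then show "AE \<omega> in M. lbi \<omega> (i_bar \<omega>) = 0" by simp
qed

text \<open>Minimality of the saddle point in the primal variable is the hypothesis of
  \<open>nonanticipativity_multiplier\<close>; dual feasibility of \<open>lbi\<close> provides the
  convexity.\<close>

lemma saddle_point_imp_multiplier:
  assumes saddle: "saddle_point (X_space M) (Lambda_space M) \<L> (xb1, xb2) (lbe, lbi)"
  obtains \<rho> :: "'m \<Rightarrow> 'x1 \<Rightarrow>\<^sub>L real" where "integrable M \<rho>"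
    "\<And>x1. x1 \<in> C1 \<Longrightarrow> J1 xb1 + integral\<^sup>L M \<rho> xb1 \<le> J1 x1 + integral\<^sup>L M \<rho> x1"
    "AE \<omega> in M. \<forall>x1. \<forall>x2\<in>C2. \<phi> lbe lbi (xb1, xb2 \<omega>) \<omega> - \<rho> \<omega> xb1 \<le> \<phi> lbe lbi (x1, x2) \<omega> - \<rho> \<omega> x1"
proof -
  note feas = saddle_point_feasible[OF saddle]
  show thesis
  proof (rule nonanticipativity_multiplier[OF dominated_integrand_lagrangian[OF lbe lbi] _
        data_sets(2,4) J1_convex feas(1) xb2 feas(2)])
    show "AE \<omega> in M. convex_on UNIV (\<lambda>z. \<phi> lbe lbi z \<omega>)"
      using feas(3) AE_space by eventually_elim (rule convex_lagrangian_integrand)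
    fix x1 x2 assume x: "x1 \<in> C1" "x2 \<in> L_infinity M" "AE \<omega> in M. x2 \<omega> \<in> C2"
    have "\<L> (xb1, xb2) (lbe, lbi) \<le> \<L> (x1, x2) (lbe, lbi)"
      using saddle x by (auto simp: saddle_point_def X_space_def)
    then show "J1 xb1 + (LINT \<omega>|M. \<phi> lbe lbi (xb1, xb2 \<omega>) \<omega>) \<le> J1 x1 + (LINT \<omega>|M. \<phi> lbe lbi (x1, x2 \<omega>) \<omega>)"
      using feas xb2 lbe lbi x by (simp add: lagrangian_eq)
  qed (rule that)
qed

text \<open>In the multiplier, \<open>e_bar\<close> kills the first pairing and the second is at
  most 0, the value attained by \<open>lbi\<close>. In the decision, integrating the pointwise
  inequality along \<open>x2 \<omega>\<close> and adding \<open>min1\<close> makes the terms with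
  \<open>\<rho>\<close> cancel.\<close>

lemma saddle_pointI:
  fixes \<rho> :: "'m \<Rightarrow> 'x1 \<Rightarrow>\<^sub>L real"
  assumes \<rho>: "integrable M \<rho>"
    and min1: "\<And>x1. x1 \<in> C1 \<Longrightarrow> J1 xb1 + integral\<^sup>L M \<rho> xb1 \<le> J1 x1 + integral\<^sup>L M \<rho> x1"
    and min2: "AE \<omega> in M. \<forall>x1. \<forall>x2\<in>C2. \<phi> lbe lbi (xb1, xb2 \<omega>) \<omega> - \<rho> \<omega> xb1 \<le> \<phi> lbe lbi (x1, x2) \<omega> - \<rho> \<omega> x1"
    and xb1: "xb1 \<in> C1" and xb2C: "AE \<omega> in M. xb2 \<omega> \<in> C2" and lbiK: "AE \<omega> in M. lbi \<omega> \<in> dual_cone K"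
    and eb0: "AE \<omega> in M. e_bar \<omega> = 0" and ibK: "AE \<omega> in M. - i_bar \<omega> \<in> K" and compl: "AE \<omega> in M. lbi \<omega> (i_bar \<omega>) = 0"
  shows "saddle_point (X_space M) (Lambda_space M) \<L> (xb1, xb2) (lbe, lbi)"
  unfolding saddle_point_def
proof (intro conjI ballI)
  show "(xb1, xb2) \<in> X_space M" "(lbe, lbi) \<in> Lambda_space M"
    using xb2 lbe lbi by (auto simp: X_space_def Lambda_space_def)
  note bar = lagrangian_eq[OF xb1 xb2 xb2C lbe lbi lbiK]
  fix l :: "('m \<Rightarrow> 'w \<Rightarrow>\<^sub>L real) \<times> ('m \<Rightarrow> 'r \<Rightarrow>\<^sub>L real)"
  assume l: "l \<in> Lambda_space M"
  obtain le li where l_eq: "l = (le, li)" by (cases l)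
  show "\<L> (xb1, xb2) l \<le> \<L> (xb1, xb2) (lbe, lbi)"
  proof (cases "AE \<omega> in M. li \<omega> \<in> dual_cone K")
    case True
    have int: "integrable M le" "integrable M li" using l by (auto simp: l_eq Lambda_space_def)
    have "(LINT \<omega>|M. le \<omega> (e_bar \<omega>)) = (LINT \<omega>|M. lbe \<omega> (e_bar \<omega>))"
      using eb0 integrable_pairing[OF int(1) e_bar] integrable_pairing[OF lbe e_bar]
      by (intro integral_cong_AE) auto
    moreover have "(LINT \<omega>|M. li \<omega> (i_bar \<omega>)) \<le> (LINT \<omega>|M. lbi \<omega> (i_bar \<omega>))"
    proof (intro integral_mono_AE integrable_pairing int lbi i_bar)
      show "AE \<omega> in M. li \<omega> (i_bar \<omega>) \<le> lbi \<omega> (i_bar \<omega>)"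
        using True ibK compl by eventually_elim (auto simp: dual_cone_def blinfun.minus_right dest!: bspec)
    qed
    ultimately show ?thesis
      using lagrangian_eq[OF xb1 xb2 xb2C int True] bar
      by (simp add: l_eq integral_\<phi>_bar int lbe lbi)
  next
    case False
    then have "\<L> (xb1, xb2) l = - \<infinity>"
      using xb1 xb2 xb2C by (simp add: l_eq lagrangian_def X0_set_def X_space_def Lambda0_set_def)
    then show ?thesis by simp
  qed
  fix x :: "'x1 \<times> ('m \<Rightarrow> 'x2)" assume x: "x \<in> X_space M"
  obtain x1 x2 where x_eq: "x = (x1, x2)" by (cases x)
  show "\<L> (xb1, xb2) (lbe, lbi) \<le> \<L> x (lbe, lbi)"
  proof (cases "x1 \<in> C1 \<and> (AE \<omega> in M. x2 \<omega> \<in> C2)")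
    case True
    then have x': "x1 \<in> C1" "x2 \<in> L_infinity M" "AE \<omega> in M. x2 \<omega> \<in> C2"
      using x by (auto simp: x_eq X_space_def)
    have \<rho>x: "integrable M (\<lambda>\<omega>. \<rho> \<omega> y)" and E\<rho>: "(LINT \<omega>|M. \<rho> \<omega> y) = integral\<^sup>L M \<rho> y" for y
      by (rule integrable_bounded_linear[OF blinfun.bounded_linear_left \<rho>],
          rule integral_bounded_linear[OF blinfun.bounded_linear_left \<rho>])
    note int\<phi> = integrable_\<phi>[OF lbe lbi]
    have "(LINT \<omega>|M. \<phi> lbe lbi (xb1, xb2 \<omega>) \<omega> - \<rho> \<omega> xb1) \<le> (LINT \<omega>|M. \<phi> lbe lbi (x1, x2 \<omega>) \<omega> - \<rho> \<omega> x1)"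
    proof (intro integral_mono_AE Bochner_Integration.integrable_diff int\<phi> \<rho>x xb2 x'(2))
      show "AE \<omega> in M. \<phi> lbe lbi (xb1, xb2 \<omega>) \<omega> - \<rho> \<omega> xb1 \<le> \<phi> lbe lbi (x1, x2 \<omega>) \<omega> - \<rho> \<omega> x1"
        using min2 x'(3) by eventually_elim blast
    qed
    then have "(LINT \<omega>|M. \<phi> lbe lbi (xb1, xb2 \<omega>) \<omega>) - integral\<^sup>L M \<rho> xb1 \<le>
        (LINT \<omega>|M. \<phi> lbe lbi (x1, x2 \<omega>) \<omega>) - integral\<^sup>L M \<rho> x1"
      by (simp add: int\<phi> \<rho>x E\<rho> xb2 x'(2))
    with min1[OF x'(1)] show ?thesis
      unfolding x_eq bar lagrangian_eq[OF x' lbe lbi lbiK] by simp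
  next
    case False
    then show ?thesis by (auto simp: x_eq lagrangian_def X0_set_def)
  qed
qed

end

end

section \<open>Equivalence of saddle points and the decoupled optimality system\<close>

theorem theorem3p10:
  fixes M :: "'m measure"
    and C1 :: "'x1::{reflexive_banach, second_countable_topology} set"
    and C2 :: "'x2::{reflexive_banach, second_countable_topology} set"
    and K :: "'r::{reflexive_banach, second_countable_topology} set"
    and J1 :: "'x1 \<Rightarrow> real"
    and J2 :: "'x1 \<Rightarrow> 'x2 \<Rightarrow> real"
    and e :: "'x1 \<Rightarrow> 'x2 \<Rightarrow> 'm \<Rightarrow> 'w::{reflexive_banach, second_countable_topology}"
    and i :: "'x1 \<Rightarrow> 'x2 \<Rightarrow> 'm \<Rightarrow> 'r"
    and xb1 :: 'x1 and xb2 :: "'m \<Rightarrow> 'x2"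
    and lbe :: "'m \<Rightarrow> 'w \<Rightarrow>\<^sub>L real" and lbi :: "'m \<Rightarrow> 'r \<Rightarrow>\<^sub>L real"
  assumes "prob_space M" and "complete_measure M"
    and "basic_assumption M C1 C2 K J1 J2 e i"
    and "xb2 \<in> L_infinity M" and "integrable M lbe" and "integrable M lbi"
  shows "saddle_point (X_space M) (Lambda_space M) (lagrangian M C1 C2 K J1 J2 e i) (xb1, xb2) (lbe, lbi)
    \<longleftrightarrow>
    (\<exists>\<rho> :: 'm \<Rightarrow> 'x1 \<Rightarrow>\<^sub>L real. integrable M \<rho> \<and>
       is_arg_min (\<lambda>x1. J1 x1 + blinfun_apply (integral\<^sup>L M \<rho>) x1) (\<lambda>x1. x1 \<in> C1) xb1 \<and>
       (AE \<omega> in M. is_arg_min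
          (\<lambda>(x1, x2). J2 x1 x2 + blinfun_apply (lbe \<omega>) (e x1 x2 \<omega>) + blinfun_apply (lbi \<omega>) (i x1 x2 \<omega>)
                        - blinfun_apply (\<rho> \<omega>) x1)
          (\<lambda>(x1, x2). x2 \<in> C2) (xb1, xb2 \<omega>)) \<and>
       xb1 \<in> C1 \<and>
       (AE \<omega> in M. e xb1 (xb2 \<omega>) \<omega> = 0 \<and> xb2 \<omega> \<in> C2 \<and> lbi \<omega> \<in> dual_cone K \<and>
          cone_le K (i xb1 (xb2 \<omega>) \<omega>) 0 \<and>
          blinfun_apply (lbi \<omega>) (i xb1 (xb2 \<omega>) \<omega>) = 0))"
proof -
  interpret prob_space M by fact
  interpret basic_problem M C1 C2 K J1 J2 e i
    by unfold_locales fact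
  note defs = e_bar_def[OF assms(4-6)] i_bar_def[OF assms(4-6)]
  show ?thesis (is "?S \<longleftrightarrow> (\<exists>\<rho>. ?R \<rho>)")
  proof
    assume S: ?S
    obtain \<rho> :: "'m \<Rightarrow> 'x1 \<Rightarrow>\<^sub>L real" where \<rho>: "integrable M \<rho>"
      "\<And>x1. x1 \<in> C1 \<Longrightarrow> J1 xb1 + integral\<^sup>L M \<rho> xb1 \<le> J1 x1 + integral\<^sup>L M \<rho> x1"
      "AE \<omega> in M. \<forall>x1. \<forall>x2\<in>C2. \<phi> lbe lbi (xb1, xb2 \<omega>) \<omega> - \<rho> \<omega> xb1 \<le> \<phi> lbe lbi (x1, x2) \<omega> - \<rho> \<omega> x1"
      by (rule saddle_point_imp_multiplier[OF assms(4-6) S]) (rule that)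
    note feas = saddle_point_feasible[OF assms(4-6) S]
      and constr = saddle_point_imp_constraints[OF assms(4-6) S, unfolded defs]
    have "?R \<rho>"
    proof (intro conjI \<rho>(1) feas(1))
      show "is_arg_min (\<lambda>x1. J1 x1 + integral\<^sup>L M \<rho> x1) (\<lambda>x1. x1 \<in> C1) xb1"
        using \<rho>(2) feas(1) by (auto simp: is_arg_min_linorder)
      show "AE \<omega> in M. is_arg_min
          (\<lambda>(x1, x2). J2 x1 x2 + blinfun_apply (lbe \<omega>) (e x1 x2 \<omega>) + blinfun_apply (lbi \<omega>) (i x1 x2 \<omega>)
                        - blinfun_apply (\<rho> \<omega>) x1)
          (\<lambda>(x1, x2). x2 \<in> C2) (xb1, xb2 \<omega>)"
        using \<rho>(3) feas(2)
        by eventually_elim (auto simp: is_arg_min_linorder lagrangian_integrand_def)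
      show "AE \<omega> in M. e xb1 (xb2 \<omega>) \<omega> = 0 \<and> xb2 \<omega> \<in> C2 \<and> lbi \<omega> \<in> dual_cone K \<and>
          cone_le K (i xb1 (xb2 \<omega>) \<omega>) 0 \<and> blinfun_apply (lbi \<omega>) (i xb1 (xb2 \<omega>) \<omega>) = 0"
        using feas(2,3) constr by eventually_elim (simp add: cone_le_def)
    qed
    then show "\<exists>\<rho>. ?R \<rho>" by (rule exI[of _ \<rho>])
  next
    assume "\<exists>\<rho>. ?R \<rho>"
    then obtain \<rho> :: "'m \<Rightarrow> 'x1 \<Rightarrow>\<^sub>L real" where \<rho>: "?R \<rho>" ..
    then show ?S
      by (intro saddle_pointI[OF assms(4-6), of \<rho>])
        (auto simp: is_arg_min_linorder lagrangian_integrand_def cone_le_def defs Ball_def)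
  qed
qed

end
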